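(* Let $A$ be a unital C*-algebra and let $\{x_j : j\in\mathbb J\}$, $\{y_j : j\in\mathbb J\}$ be standard normalized tight frames of Hilbert $A$-modules $\mathcal H_1$ and $\mathcal H_2$, respectively, with frame transforms $\theta_1,\theta_2$. Then the following are equivalent: (a) the frames are unitarily equivalent; (b) $\theta_1$ and $\theta_2$ have the same range in $l_2(A)$; (c) the sums $\sum_ja_jx_j$ and $\sum_ja_jy_j$ equal zero for exactly the same Banach $A$-submodule of sequences $\{a_j : j\in\mathbb J\}$ of $l_2(A)'$. Similarly, two standard frames $\{x_j : j\in\mathbb J\}$ of $\mathcal H_1$ and $\{y_j : j\in\mathbb J\}$ of $\mathcal H_2$ are similar if and only if their frame transforms have the same range in $l_2(A)$, if and only if the sums $\sum_ja_jx_j$ and $\sum_ja_jy_j$ equal zero for exactly the same Banach $A$-submodule of sequences $\{a_j : j\in\mathbb J\}$ of $l_2(A)'$.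
   Context: A (left) Hilbert $A$-module is a left $A$-module $\mathcal H$ with an $A$-valued inner product $\langle\cdot,\cdot\rangle$, $A$-linear in the first argument, with $\langle x,y\rangle=\langle y,x\rangle^*$, $\langle x,x\rangle\ge0$ and $=0$ only for $x=0$, complete in $\|x\|=\|\langle x,x\rangle\|^{1/2}$. $l_2(A)$ is the module of sequences $(a_j)$ in $A$ with $\sum_ja_ja_j^*$ norm-convergent, inner product $\sum_ja_jb_j^*$; $l_2(A)'$ is the Banach $A$-module of sequences $(a_j)$ in $A$ with $\sup_N\|\sum_{j=1}^Na_ja_j^*\|<\infty$ (the $A$-dual of $l_2(A)$). A sequence $\{x_j:j\in\mathbb J\}$ ($\mathbb J$ finite or countable) is a frame if there are $C,D>0$ with $C\langle x,x\rangle\le\sum_j\langle x,x_j\rangle\langle x_j,x\rangle\le D\langle x,x\rangle$ for all $x$; normalized tight if $C=D=1$ works; standard if this series converges in norm for all $x$. The frame transform is $\theta(x)=\{\langle x,x_j\rangle\}_j\in l_2(A)$. Frames $\{x_j\}$ of $\mathcal H_1$ and $\{y_j\}$ of $\mathcal H_2$ are unitarily equivalent if there is a unitary $A$-linear $U:\mathcal H_1\to\mathcal H_2$ with $U(x_j)=y_j$ for all $j$, and similar if there is such a $U$ that is merely bounded, adjointable, $A$-linear and invertible. *)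

theory Defs
  imports "HOL-Analysis.Analysis"
begin

definition cstar_algebra :: "(complex \<Rightarrow> 'a::{real_normed_algebra_1,banach} \<Rightarrow> 'a) \<Rightarrow> ('a \<Rightarrow> 'a) \<Rightarrow> bool" where
  "cstar_algebra cs st \<longleftrightarrow>
     (\<forall>c a b. cs c (a + b) = cs c a + cs c b) \<and>
     (\<forall>c d a. cs (c + d) a = cs c a + cs d a) \<and>
     (\<forall>c d a. cs (c * d) a = cs c (cs d a)) \<and>
     (\<forall>r a. cs (complex_of_real r) a = r *\<^sub>R a) \<and>
     (\<forall>c a. norm (cs c a) = cmod c * norm a) \<and>
     (\<forall>c a b. cs c (a * b) = cs c a * b) \<and>
     (\<forall>c a b. a * cs c b = cs c (a * b)) \<and>
     (\<forall>a. st (st a) = a) \<and>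
     (\<forall>a b. st (a + b) = st a + st b) \<and>
     (\<forall>c a. st (cs c a) = cs (cnj c) (st a)) \<and>
     (\<forall>a b. st (a * b) = st b * st a) \<and>
     (\<forall>a. norm (st a * a) = (norm a)\<^sup>2)"

definition alg_invertible :: "'a::ring_1 \<Rightarrow> bool" where
  "alg_invertible a \<longleftrightarrow> (\<exists>b. a * b = 1 \<and> b * a = 1)"

definition cspectrum :: "(complex \<Rightarrow> 'a::{real_normed_algebra_1,banach} \<Rightarrow> 'a) \<Rightarrow> 'a \<Rightarrow> complex set" where
  "cspectrum cs a = {z. \<not> alg_invertible (a - cs z 1)}"

definition cpos :: "(complex \<Rightarrow> 'a::{real_normed_algebra_1,banach} \<Rightarrow> 'a) \<Rightarrow> ('a \<Rightarrow> 'a) \<Rightarrow> 'a \<Rightarrow> bool" where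
  "cpos cs st a \<longleftrightarrow> st a = a \<and> (\<forall>z\<in>cspectrum cs a. z \<in> \<real> \<and> 0 \<le> Re z)"

definition cle :: "(complex \<Rightarrow> 'a::{real_normed_algebra_1,banach} \<Rightarrow> 'a) \<Rightarrow> ('a \<Rightarrow> 'a) \<Rightarrow> 'a \<Rightarrow> 'a \<Rightarrow> bool" where
  "cle cs st a b \<longleftrightarrow> cpos cs st (b - a)"

definition hnorm :: "('h \<Rightarrow> 'h \<Rightarrow> 'a::real_normed_vector) \<Rightarrow> 'h \<Rightarrow> real" where
  "hnorm ip x = sqrt (norm (ip x x))"

definition hconv :: "('h::ab_group_add \<Rightarrow> 'h \<Rightarrow> 'a::real_normed_vector) \<Rightarrow> (nat \<Rightarrow> 'h) \<Rightarrow> 'h \<Rightarrow> bool" where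
  "hconv ip f l \<longleftrightarrow> (\<lambda>n. hnorm ip (f n - l)) \<longlonglongrightarrow> 0"

definition hilbert_module ::
  "(complex \<Rightarrow> 'a::{real_normed_algebra_1,banach} \<Rightarrow> 'a) \<Rightarrow> ('a \<Rightarrow> 'a) \<Rightarrow>
   ('a \<Rightarrow> 'h::ab_group_add \<Rightarrow> 'h) \<Rightarrow> ('h \<Rightarrow> 'h \<Rightarrow> 'a) \<Rightarrow> bool" where
  "hilbert_module cs st act ip \<longleftrightarrow>
     (\<forall>a x y. act a (x + y) = act a x + act a y) \<and>
     (\<forall>a b x. act (a + b) x = act a x + act b x) \<and>
     (\<forall>a b x. act (a * b) x = act a (act b x)) \<and>
     (\<forall>x. act 1 x = x) \<and>
     (\<forall>x y z. ip (x + y) z = ip x z + ip y z) \<and>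
     (\<forall>a x y. ip (act a x) y = a * ip x y) \<and>
     (\<forall>x y. ip x y = st (ip y x)) \<and>
     (\<forall>x. cpos cs st (ip x x)) \<and>
     (\<forall>x. ip x x = 0 \<longrightarrow> x = 0) \<and>
     (\<forall>f. (\<forall>e>0. \<exists>N. \<forall>m\<ge>N. \<forall>n\<ge>N. hnorm ip (f m - f n) < e) \<longrightarrow> (\<exists>l. hconv ip f l))"

definition psum :: "nat set \<Rightarrow> (nat \<Rightarrow> 'b::comm_monoid_add) \<Rightarrow> nat \<Rightarrow> 'b" where
  "psum J f N = (\<Sum>j\<in>J \<inter> {..<N}. f j)"

definition standard_frame ::
  "(complex \<Rightarrow> 'a::{real_normed_algebra_1,banach} \<Rightarrow> 'a) \<Rightarrow> ('a \<Rightarrow> 'a) \<Rightarrow>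
   ('h \<Rightarrow> 'h \<Rightarrow> 'a) \<Rightarrow> nat set \<Rightarrow> (nat \<Rightarrow> 'h) \<Rightarrow> bool" where
  "standard_frame cs st ip J xs \<longleftrightarrow>
     (\<exists>C D. C > 0 \<and> D > 0 \<and>
        (\<forall>x. \<exists>s. (\<lambda>N. psum J (\<lambda>j. ip x (xs j) * ip (xs j) x) N) \<longlonglongrightarrow> s \<and>
                 cle cs st (C *\<^sub>R ip x x) s \<and> cle cs st s (D *\<^sub>R ip x x)))"

definition standard_nt_frame ::
  "(complex \<Rightarrow> 'a::{real_normed_algebra_1,banach} \<Rightarrow> 'a) \<Rightarrow> ('a \<Rightarrow> 'a) \<Rightarrow>
   ('h \<Rightarrow> 'h \<Rightarrow> 'a) \<Rightarrow> nat set \<Rightarrow> (nat \<Rightarrow> 'h) \<Rightarrow> bool" where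
  "standard_nt_frame cs st ip J xs \<longleftrightarrow>
     (\<forall>x. \<exists>s. (\<lambda>N. psum J (\<lambda>j. ip x (xs j) * ip (xs j) x) N) \<longlonglongrightarrow> s \<and>
              cle cs st (ip x x) s \<and> cle cs st s (ip x x))"

definition frame_transform :: "('h \<Rightarrow> 'h \<Rightarrow> 'a::zero) \<Rightarrow> nat set \<Rightarrow> (nat \<Rightarrow> 'h) \<Rightarrow> 'h \<Rightarrow> nat \<Rightarrow> 'a" where
  "frame_transform ip J xs x = (\<lambda>j. if j \<in> J then ip x (xs j) else 0)"

definition l2_dual :: "('a::{real_normed_algebra_1,banach} \<Rightarrow> 'a) \<Rightarrow> nat set \<Rightarrow> (nat \<Rightarrow> 'a) set" where
  "l2_dual st J = {a. (\<forall>j. j \<notin> J \<longrightarrow> a j = 0) \<and>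
                      bdd_above (range (\<lambda>N. norm (psum J (\<lambda>j. a j * st (a j)) N)))}"

definition synth_kernel ::
  "('a::{real_normed_algebra_1,banach} \<Rightarrow> 'a) \<Rightarrow> ('a \<Rightarrow> 'h::ab_group_add \<Rightarrow> 'h) \<Rightarrow> ('h \<Rightarrow> 'h \<Rightarrow> 'a) \<Rightarrow>
   nat set \<Rightarrow> (nat \<Rightarrow> 'h) \<Rightarrow> (nat \<Rightarrow> 'a) set" where
  "synth_kernel st act ip J xs =
     {a \<in> l2_dual st J. hconv ip (\<lambda>N. psum J (\<lambda>j. act (a j) (xs j)) N) 0}"

definition A_linear :: "('a \<Rightarrow> 'h1::plus \<Rightarrow> 'h1) \<Rightarrow> ('a \<Rightarrow> 'h2::plus \<Rightarrow> 'h2) \<Rightarrow> ('h1 \<Rightarrow> 'h2) \<Rightarrow> bool" where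
  "A_linear act1 act2 U \<longleftrightarrow> (\<forall>x y. U (x + y) = U x + U y) \<and> (\<forall>a x. U (act1 a x) = act2 a (U x))"

definition is_adjoint :: "('h1 \<Rightarrow> 'h1 \<Rightarrow> 'a) \<Rightarrow> ('h2 \<Rightarrow> 'h2 \<Rightarrow> 'a) \<Rightarrow> ('h1 \<Rightarrow> 'h2) \<Rightarrow> ('h2 \<Rightarrow> 'h1) \<Rightarrow> bool" where
  "is_adjoint ip1 ip2 U V \<longleftrightarrow> (\<forall>x y. ip2 (U x) y = ip1 x (V y))"

definition unitary_op ::
  "('a \<Rightarrow> 'h1::plus \<Rightarrow> 'h1) \<Rightarrow> ('h1 \<Rightarrow> 'h1 \<Rightarrow> 'a) \<Rightarrow> ('a \<Rightarrow> 'h2::plus \<Rightarrow> 'h2) \<Rightarrow> ('h2 \<Rightarrow> 'h2 \<Rightarrow> 'a) \<Rightarrow> ('h1 \<Rightarrow> 'h2) \<Rightarrow> bool" where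
  "unitary_op act1 ip1 act2 ip2 U \<longleftrightarrow> A_linear act1 act2 U \<and>
     (\<exists>V. is_adjoint ip1 ip2 U V \<and> (\<forall>x. V (U x) = x) \<and> (\<forall>y. U (V y) = y))"

definition similarity_op ::
  "('a::real_normed_vector \<Rightarrow> 'h1::plus \<Rightarrow> 'h1) \<Rightarrow> ('h1 \<Rightarrow> 'h1 \<Rightarrow> 'a) \<Rightarrow> ('a \<Rightarrow> 'h2::plus \<Rightarrow> 'h2) \<Rightarrow> ('h2 \<Rightarrow> 'h2 \<Rightarrow> 'a) \<Rightarrow> ('h1 \<Rightarrow> 'h2) \<Rightarrow> bool" where
  "similarity_op act1 ip1 act2 ip2 U \<longleftrightarrow> A_linear act1 act2 U \<and>
     (\<exists>K. \<forall>x. hnorm ip2 (U x) \<le> K * hnorm ip1 x) \<and>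
     (\<exists>V. is_adjoint ip1 ip2 U V) \<and> bij U"

definition unitarily_equivalent_frames where
  "unitarily_equivalent_frames act1 ip1 act2 ip2 J xs ys \<longleftrightarrow>
     (\<exists>U. unitary_op act1 ip1 act2 ip2 U \<and> (\<forall>j\<in>J. U (xs j) = ys j))"

definition similar_frames where
  "similar_frames act1 ip1 act2 ip2 J xs ys \<longleftrightarrow>
     (\<exists>U. similarity_op act1 ip1 act2 ip2 U \<and> (\<forall>j\<in>J. U (xs j) = ys j))"

end

(*
  Write \<theta> for the frame transform, S = \<theta>*\<theta> for the frame operator, and G x = sum_j <x, x_j> y_j.
  The frame inequality makes 1 - S/D a positive operator of norm at most 1 - C/D, so S is invertible by
  a fixed-point argument.  If the ranges agree, T = S2^-1 G satisfies \<theta>2 T = \<theta>1; it is invertible,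
  its inverse has the adjoint U = G S1^-1, and U maps x_j to y_j.  For normalized tight frames S = 1,
  so that U = G = T is unitary.  Conversely an operator U with U x_j = y_j gives \<theta>2 = \<theta>1 U*; that U*
  is onto follows from U^-1 = G* S2^-1, which is adjointable.  Finally c = \<theta>1 x - \<theta>2 (S2^-1 G x) is
  annihilated by the synthesis of the y_j; if it is also annihilated by that of the x_j then
  sum_j c_j c_j* = 0, so \<theta>1 x lies in the range of \<theta>2.

  The C*-algebraic input (norm monotonicity on the positive cone, positivity of a*a, Cauchy-Schwarz)
  is obtained without functional calculus, from square roots of 1 - b for selfadjoint contractions b
  and from the inequality |x^2| <= |x^2 + y^2| for commuting selfadjoint x, y.
*)
theory Submission
  imports Defs
begin

section \<open>Invertibility and positivity\<close>

lemma scaleR_double: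
  fixes x :: "'a::real_vector"
  shows "(2 * t) *\<^sub>R x = t *\<^sub>R x + t *\<^sub>R x"
  "(t * 2) *\<^sub>R x = t *\<^sub>R x + t *\<^sub>R x"
  by (simp_all flip: scaleR_left_distrib)

section \<open>Invertible elements of a unital Banach algebra\<close>

lemma alg_invertible_scaleR:
  fixes a :: "'a::real_normed_algebra_1"
  assumes "alg_invertible a" "r \<noteq> 0"
  shows "alg_invertible (r *\<^sub>R a)"
proof -
  obtain b where "a * b = 1" "b * a = 1" using assms by (auto simp: alg_invertible_def)
  then show ?thesis unfolding alg_invertible_def using assms(2)
    by (intro exI[of _ "inverse r *\<^sub>R b"]) simp
qed

lemma alg_invertible_mult:
  assumes "alg_invertible a" "alg_invertible b"
  shows "alg_invertible (a * b)"
proof -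
  obtain a' b' where "a * a' = 1" "a' * a = 1" "b * b' = 1" "b' * b = 1"
    using assms by (auto simp: alg_invertible_def)
  then have "a * b * (b' * a') = 1" "b' * a' * (a * b) = 1"
    by (metis mult.assoc mult_1_right)+
  then show ?thesis unfolding alg_invertible_def by blast
qed

text \<open>\<open>d * b\<close> is a left inverse, by commutation, and \<open>b * d\<close> a right
  one; two such inverses coincide.\<close>

lemma alg_invertible_factor:
  assumes "alg_invertible (a * b)" "a * b = b * a"
  shows "alg_invertible a"
proof -
  obtain d where d: "a * b * d = 1" "d * (a * b) = 1"
    using assms by (auto simp: alg_invertible_def)
  have "d * b * a = 1" using d assms(2) by (simp add: mult.assoc)
  moreover have "a * (b * d) = 1" using d by (simp add: mult.assoc)
  ultimately show ?thesis unfolding alg_invertible_def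
    by (metis mult.assoc mult_1_left mult_1_right)
qed

text \<open>Neumann series: splitting off the first term of the sum \<open>S\<close> of the powers
  of \<open>b\<close> gives \<open>S = 1 + b * S = 1 + S * b\<close>.\<close>

lemma alg_invertible_one_minus:
  fixes b :: "'a::{real_normed_algebra_1,banach}"
  assumes "norm b < 1"
  shows "alg_invertible (1 - b)"
proof -
  have "summable (\<lambda>n. norm (b ^ n))"
    using assms by (intro summable_comparison_test'[OF summable_geometric[of "norm b"]])
      (auto simp: norm_power_ineq)
  then have s: "summable (\<lambda>n. b ^ n)" by (rule summable_norm_cancel)
  define S where "S = (\<Sum>n. b ^ n)"
  have S: "S = 1 + (\<Sum>n. b ^ Suc n)" unfolding S_def using suminf_split_head[OF s] by simp
  have "S = 1 + b * S" using S suminf_mult[OF s, of b] by (simp add: S_def)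
  moreover have "S = 1 + S * b" using S suminf_mult2[OF s, of b]
    by (simp add: S_def power_Suc2 del: power_Suc)
  ultimately have "(1 - b) * S = 1" "S * (1 - b) = 1" by (simp_all add: algebra_simps)
  then show ?thesis unfolding alg_invertible_def by blast
qed

lemma alg_invertible_scaleR_minus:
  fixes b :: "'a::{real_normed_algebra_1,banach}"
  assumes "norm b < t"
  shows "alg_invertible (t *\<^sub>R 1 - b)"
proof -
  have t: "t > 0" using assms norm_ge_zero[of b] by linarith
  have "alg_invertible (1 - inverse t *\<^sub>R b)"
    using assms t by (intro alg_invertible_one_minus) (simp add: field_simps)
  then have "alg_invertible (t *\<^sub>R (1 - inverse t *\<^sub>R b))"
    using t by (intro alg_invertible_scaleR) auto
  then show ?thesis using t by (simp add: scaleR_diff_right)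
qed

text \<open>The inverse is \<open>1 + y * d * x\<close>, where \<open>d\<close> inverts
  \<open>1 - x * y\<close>. This is how positivity will pass from \<open>- (st x * x)\<close> to
  \<open>- (x * st x)\<close>.\<close>

lemma alg_invertible_one_minus_swap:
  fixes x y :: "'a::ring_1"
  assumes "alg_invertible (1 - x * y)"
  shows "alg_invertible (1 - y * x)"
proof -
  obtain d where d: "(1 - x * y) * d = 1" "d * (1 - x * y) = 1"
    using assms by (auto simp: alg_invertible_def)
  have "(1 - y * x) * (1 + y * d * x) = 1 - y * x + y * ((1 - x * y) * d) * x"
    by (simp add: algebra_simps)
  then have 1: "(1 - y * x) * (1 + y * d * x) = 1" using d by simp
  have "(1 + y * d * x) * (1 - y * x) = 1 - y * x + y * (d * (1 - x * y)) * x"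
    by (simp add: algebra_simps)
  then have 2: "(1 + y * d * x) * (1 - y * x) = 1" using d by simp
  show ?thesis unfolding alg_invertible_def using 1 2 by blast
qed

section \<open>C*-algebras and their involution\<close>

locale cstar =
  fixes cs :: "complex \<Rightarrow> 'a::{real_normed_algebra_1,banach} \<Rightarrow> 'a"
    and st :: "'a \<Rightarrow> 'a"
  assumes cstar: "cstar_algebra cs st"
begin

lemma cs_add: "cs c (a + b) = cs c a + cs c b"
  and cs_mult: "cs (c * d) a = cs c (cs d a)"
  and cs_of_real: "cs (complex_of_real r) a = r *\<^sub>R a"
  and cs_mult_left: "cs c a * b = cs c (a * b)"
  and cs_mult_right: "a * cs c b = cs c (a * b)"
  and st_st [simp]: "st (st a) = a"
  and st_add: "st (a + b) = st a + st b"
  and st_cs: "st (cs c a) = cs (cnj c) (st a)"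
  and st_mult: "st (a * b) = st b * st a"
  and norm_st_mult: "norm (st a * a) = (norm a)\<^sup>2"
  using cstar unfolding cstar_algebra_def by auto

lemma st_scaleR: "st (r *\<^sub>R a) = r *\<^sub>R st a"
  by (metis cs_of_real st_cs complex_cnj_complex_of_real)

lemma st_zero [simp]: "st 0 = 0"
  by (metis st_scaleR scaleR_zero_left)

lemma st_minus: "st (- a) = - st a"
  by (metis st_scaleR scaleR_minus1_left)

lemma st_diff: "st (a - b) = st a - st b"
  by (metis st_add st_minus diff_conv_add_uminus)

lemma st_one [simp]: "st 1 = 1"
  by (metis st_mult st_st mult_1_left mult_1_right)

lemma st_sum: "st (\<Sum>i\<in>I. f i) = (\<Sum>i\<in>I. st (f i))"
  by (induction I rule: infinite_finite_induct) (auto simp: st_add)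

lemma norm_st [simp]: "norm (st a) = norm a"
proof -
  have *: "norm a \<le> norm (st a)" for a
  proof (cases "a = 0")
    case False
    have "norm a * norm a \<le> norm (st a) * norm a"
      using norm_st_mult[of a] norm_mult_ineq[of "st a" a] by (simp add: power2_eq_square)
    then show ?thesis using False by simp
  qed simp
  show ?thesis using *[of a] *[of "st a"] by simp
qed

lemma norm_mult_st: "norm (a * st a) = (norm a)\<^sup>2"
  using norm_st_mult[of "st a"] by simp

lemma norm_square_herm: "st a = a \<Longrightarrow> norm (a * a) = (norm a)\<^sup>2"
  using norm_st_mult[of a] by simp

lemma st_tendsto:
  assumes "(f \<longlongrightarrow> l) F" shows "((\<lambda>n. st (f n)) \<longlongrightarrow> st l) F"
proof -
  have "((\<lambda>n. norm (f n - l)) \<longlongrightarrow> 0) F"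
    using assms by (simp add: tendsto_norm_zero LIM_zero)
  then have "((\<lambda>n. norm (st (f n) - st l)) \<longlongrightarrow> 0) F"
    by (simp add: st_diff[symmetric])
  then show ?thesis by (simp add: tendsto_norm_zero_iff LIM_zero_iff)
qed

section \<open>Selfadjoint elements: square roots and the spectral radius\<close>

abbreviation ci :: "'a \<Rightarrow> 'a" where "ci \<equiv> cs \<i>"

lemma ci_ci: "ci (ci a) = - a"
  by (metis cs_mult cs_of_real complex_i_mult_minus i_squared of_real_1 of_real_minus scaleR_minus1_left)

lemma ci_diff: "ci (a - b) = ci a - ci b"
  using cs_add[of \<i> "a - b" b] by (simp add: algebra_simps)

lemma st_ci: "st (ci a) = - ci (st a)"
proof -
  have "cs (- \<i>) (st a) = cs (-1) (ci (st a))" by (simp add: cs_mult[symmetric])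
  also have "\<dots> = - ci (st a)" using cs_of_real[of "-1" "ci (st a)"] by simp
  finally show ?thesis by (simp add: st_cs)
qed

text \<open>\<open>x\<close> is the real part of \<open>w = x + ci y\<close>, so its norm is at most
  \<open>norm w\<close>; commutation makes \<open>st w * w\<close> the sum of squares.\<close>

lemma norm_square_le_sum_squares:
  assumes "st x = x" "st y = y" "x * y = y * x"
  shows "norm (x * x) \<le> norm (x * x + y * y)"
proof -
  define w where "w = x + ci y"
  have sw: "st w = x - ci y" using assms by (simp add: w_def st_add st_ci)
  have "st w * w = x * x + y * y"
    unfolding sw using assms
    by (simp add: w_def algebra_simps cs_mult_left cs_mult_right ci_ci ci_diff)
  then have n: "norm (x * x + y * y) = (norm w)\<^sup>2" using norm_st_mult[of w] by simp
  have "x = (1/2) *\<^sub>R (w + st w)" unfolding sw by (simp add: w_def scaleR_add_right flip: scaleR_add_left)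
  then have "norm x = norm (w + st w) / 2" by (metis abs_of_pos divide_inverse mult.commute mult_1_left norm_scaleR zero_less_divide_1_iff zero_less_numeral inverse_eq_divide)
  then have "norm x \<le> norm w"
    using norm_triangle_ineq[of w "st w"] by simp
  then show ?thesis unfolding n norm_square_herm[OF assms(1)] by (simp add: power_mono)
qed

text \<open>The root is \<open>1 - l\<close>, where \<open>l\<close> is the limit of \<open>y\<^sub>n\<^sub>+\<^sub>1 = (b + y\<^sub>n\<^sup>2) / 2\<close>. The same recursion with \<open>b = 1\<close>
  in the reals dominates the increments, so norm \<open>1\<close> is allowed.\<close>

lemma sqrt_exists:
  assumes b: "st b = b" "norm b \<le> 1"
  obtains s where "st s = s" "s * s = 1 - b" "norm (1 - s) \<le> 1"
    "\<And>z. z * b = b * z \<Longrightarrow> z * s = s * z"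
proof -
  define y where "y = rec_nat 0 (\<lambda>_ y. (1/2) *\<^sub>R (b + y * y))"
  define r where "r = rec_nat 0 (\<lambda>_ r::real. (1/2) * (1 + r * r))"
  have y: "y 0 = 0" "y (Suc n) = (1/2) *\<^sub>R (b + y n * y n)" for n by (simp_all add: y_def)
  have r: "r 0 = 0" "r (Suc n) = (1/2) * (1 + r n * r n)" for n by (simp_all add: r_def)
  have r01: "0 \<le> r n \<and> r n \<le> 1" for n
    by (induction n) (auto simp: r mult_le_one)
  have yr: "norm (y n) \<le> r n" for n
  proof (induction n)
    case (Suc n)
    have "norm (y (Suc n)) \<le> (1/2) * (norm b + norm (y n * y n))"
      unfolding y using norm_triangle_ineq[of b "y n * y n"] by simp
    also have "norm (y n * y n) \<le> r n * r n"
      using norm_mult_ineq[of "y n" "y n"] mult_mono[OF Suc Suc] r01[of n] by simp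
    finally show ?case unfolding r using b by simp
  qed (simp add: y r)
  \<comment> \<open>The increment of \<open>r\<close> is half the square of
    \<open>1 - r n\<close>.\<close>
  have rinc: "r n \<le> r (Suc n)" for n
    using zero_le_square[of "1 - r n"] by (simp add: r algebra_simps)
  have ydiff: "norm (y (Suc n) - y n) \<le> r (Suc n) - r n" for n
  proof (induction n)
    case 0 then show ?case using b by (simp add: y r)
  next
    case (Suc n)
    let ?u = "y (Suc n)" and ?v = "y n"
    \<comment> \<open>A difference of squares, factored with the order of the factors kept;
      \<open>r\<close> satisfies the same identity, so the two bounds match.\<close>
    have "y (Suc (Suc n)) - y (Suc n) = (1/2) *\<^sub>R ((?u - ?v) * ?u + ?v * (?u - ?v))"
      unfolding y(2)[of "Suc n"] by (subst (3) y(2)) (simp add: algebra_simps)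
    also have "norm \<dots> \<le> (1/2) * (norm ((?u - ?v) * ?u) + norm (?v * (?u - ?v)))"
      by (simp add: norm_triangle_ineq)
    also have "\<dots> \<le> (1/2) * ((r (Suc n) - r n) * r (Suc n) + r n * (r (Suc n) - r n))"
      using norm_mult_ineq[of "?u - ?v" ?u] norm_mult_ineq[of ?v "?u - ?v"]
        mult_mono[OF Suc yr[of "Suc n"]] mult_mono[OF yr[of n] Suc] rinc[of n] r01[of n]
      by fastforce
    also have "\<dots> = r (Suc (Suc n)) - r (Suc n)"
      unfolding r(2)[of "Suc n"] by (subst (4) r(2)) (simp add: algebra_simps)
    finally show ?case .
  qed
  have "incseq r" using rinc by (simp add: incseq_SucI)
  then have "convergent r" using r01 by (intro Bseq_monoseq_convergent BseqI'[of _ 1])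
      (auto simp: incseq_imp_monoseq)
  then have "summable (\<lambda>n. r (Suc n) - r n)"
    by (metis convergent_def telescope_summable)
  then have "summable (\<lambda>n. y (Suc n) - y n)"
    by (rule summable_comparison_test'[where N = 0]) (rule ydiff)
  then have "convergent (\<lambda>n. \<Sum>k<n. y (Suc k) - y k)"
    using summable_iff_convergent by blast
  then have "convergent y" unfolding sum_lessThan_telescope y(1) by simp
  then obtain l where l: "y \<longlonglongrightarrow> l" by (auto simp: convergent_def)
  have "(\<lambda>n. y (Suc n)) \<longlonglongrightarrow> (1/2) *\<^sub>R (b + l * l)"
    unfolding y by (intro tendsto_intros l)
  then have "l = (1/2) *\<^sub>R (b + l * l)" using l LIMSEQ_Suc LIMSEQ_unique by blast
  then have eq: "l + l = b + l * l" by (metis scaleR_half_double scaleR_add_right)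
  have "st (y n) = y n" for n by (induction n) (simp_all add: y st_scaleR st_add st_mult b)
  then have stl: "st l = l" using st_tendsto[OF l] l LIMSEQ_unique by auto
  have "norm (y n) \<le> 1" for n using yr[of n] r01[of n] by linarith
  then have "norm l \<le> 1" using LIMSEQ_le_const2[OF tendsto_norm[OF l]] by blast
  show ?thesis
  proof (rule that[of "1 - l"])
    show "norm (1 - (1 - l)) \<le> 1" using \<open>norm l \<le> 1\<close> by simp
    show "st (1 - l) = 1 - l" by (simp add: st_diff stl)
    show "(1 - l) * (1 - l) = 1 - b" using eq by (simp add: algebra_simps)
    fix z assume z: "z * b = b * z"
    have zy: "z * y n = y n * z" for n
    proof (induction n)
      case (Suc n)
      have "z * (y n * y n) = y n * y n * z" by (metis Suc mult.assoc)
      then show ?case unfolding y using z by (simp add: algebra_simps)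
    qed (simp add: y)
    have "(\<lambda>n. z * y n) \<longlonglongrightarrow> z * l" "(\<lambda>n. y n * z) \<longlonglongrightarrow> l * z"
      by (intro tendsto_intros l)+
    then have "z * l = l * z" unfolding zy using LIMSEQ_unique by blast
    then show "z * (1 - l) = (1 - l) * z" by (simp add: algebra_simps)
  qed
qed

text \<open>The root \<open>s\<close> of \<open>1 - a * a\<close> commutes with \<open>a\<close>,
  and the squares of \<open>s\<close> and \<open>a\<close> add up to \<open>1\<close>, so
  \<open>norm_square_le_sum_squares\<close> applies.\<close>

lemma norm_one_minus_square:
  assumes "st a = a" "norm a \<le> 1"
  shows "norm (1 - a * a) \<le> 1"
proof -
  have h: "st (a * a) = a * a" using assms by (simp add: st_mult)
  have "norm (a * a) \<le> 1" using assms by (simp add: norm_square_herm power_le_one)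
  from sqrt_exists[OF h this] obtain s where
    s: "st s = s" "s * s = 1 - a * a" "norm (1 - s) \<le> 1" "\<And>z. z * (a * a) = a * a * z \<Longrightarrow> z * s = s * z" by blast
  have "s * a = a * s" using s(4)[of a] by (simp add: mult.assoc)
  from norm_square_le_sum_squares[OF s(1) assms(1) this] show ?thesis by (simp add: s(2))
qed

text \<open>With \<open>d = (1 - a\<^sup>2)\<^sup>-\<^sup>1\<close> and \<open>M = \<parallel>d\<parallel>\<close>, the product of \<open>1 - a\<^sup>2\<close> and \<open>1 - d / M\<close> is a square \<open>u\<^sup>2\<close>,
  which gives \<open>a\<^sup>2 + u\<^sup>2 = 1 - 1 / M\<close> and hence \<open>\<parallel>a\<^sup>2\<parallel> < 1\<close>.\<close>

lemma spectral_radius_unit: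
  assumes a: "st a = a" "norm a = 1"
    and inv: "alg_invertible (1 - a)" "alg_invertible (1 + a)"
  shows False
proof -
  have sq: "(1 - a) * (1 + a) = 1 - a * a" by (simp add: algebra_simps)
  obtain d where d: "(1 - a * a) * d = 1" "d * (1 - a * a) = 1"
    using alg_invertible_mult[OF inv] unfolding sq by (auto simp: alg_invertible_def)
  have std: "st d = d"
  proof -
    have "st d * (1 - a * a) = 1" using arg_cong[OF d(1), of st] by (simp add: st_mult st_diff a)
    then have "st d * (1 - a * a) * d = d" by simp
    then show ?thesis unfolding mult.assoc d(1) by simp
  qed
  have d_comm: "z * d = d * z" if "z * (1 - a * a) = (1 - a * a) * z" for z
  proof -
    have "d * (z * (1 - a * a)) * d = d * ((1 - a * a) * z) * d" using that by simp
    then have "(d * z) * ((1 - a * a) * d) = (d * (1 - a * a)) * (z * d)"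
      by (simp only: mult.assoc)
    then show ?thesis by (simp add: d)
  qed
  define M where "M = norm d"
  have n1: "norm (1 - a * a) \<le> 1" using norm_one_minus_square a by simp
  \<comment> \<open>\<open>M \<ge> 1\<close> gives \<open>0 \<le> 1 - inverse M < 1\<close>, the
    bound on \<open>norm (a * a)\<close> that yields the contradiction.\<close>
  have "1 \<le> norm (1 - a * a) * M"
    using norm_mult_ineq[of "1 - a * a" d] d by (simp add: M_def)
  also have "\<dots> \<le> 1 * M" using n1 by (intro mult_right_mono) (auto simp: M_def)
  finally have M: "M \<ge> 1" by simp
  define e where "e = inverse M *\<^sub>R d"
  have e: "st e = e" "norm e \<le> 1" using M std unfolding e_def by (simp_all add: st_scaleR flip: M_def)
  from sqrt_exists[OF this] obtain t where
    t: "st t = t" "t * t = 1 - e" "norm (1 - t) \<le> 1" "\<And>z. z * e = e * z \<Longrightarrow> z * t = t * z" by blast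
  have h: "st (a * a) = a * a" "norm (a * a) \<le> 1"
    using a by (auto simp: st_mult norm_square_herm)
  from sqrt_exists[OF this] obtain s where
    s: "st s = s" "s * s = 1 - a * a" "norm (1 - s) \<le> 1" "\<And>z. z * (a * a) = a * a * z \<Longrightarrow> z * s = s * z" by blast
  have ad: "a * d = d * a" by (rule d_comm) (simp add: algebra_simps)
  have at: "a * t = t * a" by (rule t(4)) (simp add: e_def ad)
  have as: "a * s = s * a" by (rule s(4)) (simp add: mult.assoc)
  have "s * (1 - a * a) = (1 - a * a) * s" by (simp add: s(2)[symmetric] mult.assoc)
  from d_comm[OF this] have sd: "s * d = d * s" .
  have st: "s * t = t * s" by (rule t(4)) (simp add: e_def sd)
  define u where "u = s * t"
  have u: "st u = u" by (simp add: u_def st_mult s(1) t(1) st)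
  have "u * u = s * (t * s) * t" by (simp add: u_def mult.assoc)
  also have "\<dots> = (s * s) * (t * t)" unfolding st[symmetric] by (simp add: mult.assoc)
  also have "\<dots> = (1 - a * a) * (1 - e)" by (simp add: s(2) t(2))
  also have "\<dots> = 1 - a * a - inverse M *\<^sub>R ((1 - a * a) * d)"
    by (simp add: e_def algebra_simps)
  finally have "a * a + u * u = (1 - inverse M) *\<^sub>R 1" unfolding d by (simp add: algebra_simps)
  moreover have "a * u = u * a"
  proof -
    have "a * u = s * (a * t)" unfolding u_def mult.assoc[symmetric] as ..
    then show ?thesis by (simp add: u_def at mult.assoc)
  qed
  ultimately have "norm (a * a) \<le> norm ((1 - inverse M) *\<^sub>R (1::'a))"
    using norm_square_le_sum_squares[OF a(1) u] by simp
  moreover have "inverse M \<le> 1" "inverse M > 0" using M by (auto simp: inverse_le_1_iff)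
  ultimately show False using a by (simp add: norm_square_herm)
qed

text \<open>Stands in for the spectral radius formula: by scaling to norm 1, \<open>norm a\<close>
  or \<open>- norm a\<close> must lie in the spectrum of a nonzero selfadjoint
  \<open>a\<close>.\<close>

lemma spectral_radius:
  assumes a: "st a = a" "a \<noteq> 0"
    and inv: "alg_invertible (norm a *\<^sub>R 1 - a)" "alg_invertible (norm a *\<^sub>R 1 + a)"
  shows False
proof (rule spectral_radius_unit[of "inverse (norm a) *\<^sub>R a"])
  show "alg_invertible (1 - inverse (norm a) *\<^sub>R a)" "alg_invertible (1 + inverse (norm a) *\<^sub>R a)"
    using alg_invertible_scaleR[OF inv(1), of "inverse (norm a)"]
      alg_invertible_scaleR[OF inv(2), of "inverse (norm a)"] a
    by (simp_all add: scaleR_diff_right scaleR_add_right)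
qed (use a in \<open>simp_all add: st_scaleR\<close>)

section \<open>The positive cone\<close>

text \<open>The spectrum is only tested at the negative reals; that it is real is never needed.\<close>

definition pos :: "'a \<Rightarrow> bool" where
  "pos a \<longleftrightarrow> st a = a \<and> (\<forall>t>0. alg_invertible (a + t *\<^sub>R 1))"

lemma pos_herm: "pos a \<Longrightarrow> st a = a" by (simp add: pos_def)

lemma pos_if_cpos:
  assumes "cpos cs st a" shows "pos a"
  unfolding pos_def
proof safe
  show "st a = a" using assms by (simp add: cpos_def)
  fix t :: real assume t: "t > 0"
  have "complex_of_real (- t) \<notin> cspectrum cs a" using assms t by (auto simp: cpos_def)
  then have "alg_invertible (a - cs (complex_of_real (- t)) 1)" by (simp add: cspectrum_def)
  then show "alg_invertible (a + t *\<^sub>R 1)" unfolding cs_of_real by simp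
qed

text \<open>\<open>a + t\<close> is \<open>M + t\<close> minus an element of norm at most
  \<open>M\<close>, hence invertible by the Neumann series.\<close>

lemma pos_if_norm:
  assumes "st a = a" "norm (M *\<^sub>R 1 - a) \<le> M"
  shows "pos a"
  unfolding pos_def
proof safe
  fix t :: real assume t: "t > 0"
  then have "alg_invertible ((M + t) *\<^sub>R 1 - (M *\<^sub>R 1 - a))"
    using assms by (intro alg_invertible_scaleR_minus) simp
  then show "alg_invertible (a + t *\<^sub>R 1)" by (simp add: algebra_simps)
qed (fact assms)

text \<open>If \<open>?N > M\<close>, then \<open>?N - ?c = a + (?N - M)\<close> is invertible by
  positivity and \<open>?N + ?c = (?N + M) - a\<close> by size, contradicting
  \<open>spectral_radius\<close> for \<open>?c\<close>.\<close>

lemma norm_if_pos: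
  assumes "pos a" "norm a \<le> M"
  shows "norm (M *\<^sub>R 1 - a) \<le> M"
proof (rule ccontr)
  let ?c = "M *\<^sub>R 1 - a" and ?N = "norm (M *\<^sub>R 1 - a)"
  assume "\<not> ?N \<le> M"
  then have N: "?N > M" by simp
  have M: "M \<ge> 0" using assms(2) norm_ge_zero order_trans by blast
  have "alg_invertible (a + (?N - M) *\<^sub>R 1)" using assms N by (simp add: pos_def)
  moreover have "alg_invertible ((?N + M) *\<^sub>R 1 - a)"
    using assms N M by (intro alg_invertible_scaleR_minus) simp
  moreover have "?c \<noteq> 0" using N M by auto
  ultimately show False using spectral_radius[of ?c] assms(1)
    by (simp add: algebra_simps pos_def st_diff st_scaleR)
qed

text \<open>With a norm inequality in place of invertibility, closure under sums and limits reduces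
  to the triangle inequality and continuity.\<close>

lemma pos_iff_norm: "pos a \<longleftrightarrow> st a = a \<and> norm (norm a *\<^sub>R 1 - a) \<le> norm a"
  using pos_if_norm norm_if_pos pos_herm by blast

lemma pos_zero [simp]: "pos 0" by (simp add: pos_iff_norm)

lemma pos_add: assumes "pos a" "pos b" shows "pos (a + b)"
proof (rule pos_if_norm[where M = "norm a + norm b"])
  have "norm ((norm a *\<^sub>R 1 - a) + (norm b *\<^sub>R 1 - b)) \<le> norm a + norm b"
    using assms norm_triangle_ineq[of "norm a *\<^sub>R 1 - a" "norm b *\<^sub>R 1 - b"]
    by (auto simp: pos_iff_norm)
  then show "norm ((norm a + norm b) *\<^sub>R 1 - (a + b)) \<le> norm a + norm b"
    by (simp add: algebra_simps)
qed (use assms in \<open>simp add: st_add pos_def\<close>)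

lemma pos_sum: "(\<And>i. i \<in> I \<Longrightarrow> pos (f i)) \<Longrightarrow> pos (\<Sum>i\<in>I. f i)"
  by (induction I rule: infinite_finite_induct) (auto simp: pos_add)

lemma pos_scaleR: assumes "pos a" "r \<ge> 0" shows "pos (r *\<^sub>R a)"
proof (rule pos_if_norm[where M = "r * norm a"])
  have "norm (r *\<^sub>R (norm a *\<^sub>R 1 - a)) \<le> r * norm a"
    using assms by (simp add: pos_iff_norm mult_left_mono)
  then show "norm ((r * norm a) *\<^sub>R 1 - r *\<^sub>R a) \<le> r * norm a" by (simp add: algebra_simps)
qed (use assms in \<open>simp add: st_scaleR pos_def\<close>)

lemma pos_tendsto:
  assumes l: "f \<longlonglongrightarrow> l" and p: "\<And>n. pos (f n)"
  shows "pos l"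
proof -
  have "(\<lambda>n. norm (norm (f n) *\<^sub>R 1 - f n)) \<longlonglongrightarrow> norm (norm l *\<^sub>R 1 - l)"
    "(\<lambda>n. norm (f n)) \<longlonglongrightarrow> norm l" by (intro tendsto_intros l)+
  then have "norm (norm l *\<^sub>R 1 - l) \<le> norm l"
    using p by (intro LIMSEQ_le) (auto simp: pos_iff_norm)
  moreover have "st l = l" using st_tendsto[OF l] l p LIMSEQ_unique by (auto simp: pos_def)
  ultimately show ?thesis by (simp add: pos_iff_norm)
qed

text \<open>After scaling to norm 1, \<open>norm_one_minus_square\<close> is the criterion
  \<open>pos_if_norm\<close> with \<open>M = 1\<close>.\<close>

lemma pos_square: assumes "st a = a" shows "pos (a * a)"
proof (cases "a = 0")
  case False
  let ?b = "inverse (norm a) *\<^sub>R a"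
  have "norm (1 - ?b * ?b) \<le> 1" using assms False by (intro norm_one_minus_square) (simp_all add: st_scaleR)
  then have "pos (?b * ?b)" using assms by (intro pos_if_norm[where M = 1]) (simp_all add: st_scaleR st_mult)
  from pos_scaleR[OF this, of "norm a * norm a"] show ?thesis using False by (simp add: field_simps)
qed simp

lemma pos_scaleR_one_minus: assumes "st b = b" "norm b \<le> \<beta>" shows "pos (\<beta> *\<^sub>R 1 - b)"
  using assms by (intro pos_if_norm[where M = \<beta>]) (simp_all add: st_diff st_scaleR)

text \<open>Were \<open>norm a\<close> larger than \<open>\<beta>\<close>, both
  \<open>norm a + a\<close> and \<open>norm a - a\<close> would be invertible, against
  \<open>spectral_radius\<close>.\<close>

lemma norm_le_if_pos:
  assumes a: "pos a" "pos (\<beta> *\<^sub>R 1 - a)" and "\<beta> \<ge> 0"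
  shows "norm a \<le> \<beta>"
proof (rule ccontr)
  assume "\<not> norm a \<le> \<beta>"
  then have N: "norm a > \<beta>" by simp
  have "norm a > 0" using N \<open>\<beta> \<ge> 0\<close> by linarith
  then have "alg_invertible (a + norm a *\<^sub>R 1)" using a(1) unfolding pos_def by blast
  moreover have "alg_invertible ((\<beta> *\<^sub>R 1 - a) + (norm a - \<beta>) *\<^sub>R 1)" using a(2) N unfolding pos_def by simp
  moreover have "a \<noteq> 0" using \<open>norm a > 0\<close> by (metis norm_zero less_irrefl)
  ultimately show False using spectral_radius[of a] pos_herm[OF a(1)] by (simp add: algebra_simps)
qed

lemma pos_norm_mono:
  assumes "pos a" "pos (b - a)" shows "norm a \<le> norm b"
proof (rule norm_le_if_pos)
  have "pos b" using pos_add[OF assms] by simp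
  then have "pos (norm b *\<^sub>R 1 - b)" by (simp add: pos_scaleR_one_minus pos_herm)
  from pos_add[OF this assms(2)] show "pos (norm b *\<^sub>R 1 - a)" by simp
qed (use assms in auto)

lemma pos_antisym: "pos a \<Longrightarrow> pos (- a) \<Longrightarrow> a = 0"
  using pos_norm_mono[of a 0] by simp

text \<open>\<open>1 - a / norm a\<close> is a selfadjoint contraction, so
  \<open>sqrt_exists\<close> applies; its bound on \<open>1 - s\<close> makes the root
  positive.\<close>

lemma pos_sqrt:
  assumes "pos a"
  obtains s where "pos s" "s * s = a" "\<And>z. z * a = a * z \<Longrightarrow> z * s = s * z"
proof (cases "a = 0")
  case True then show ?thesis using that[of 0] by simp
next
  case False
  define m where "m = norm a"
  have m: "m > 0" using False by (simp add: m_def)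
  define b where "b = 1 - inverse m *\<^sub>R a"
  have "norm (inverse m *\<^sub>R (m *\<^sub>R 1 - a)) \<le> 1"
    using assms m unfolding pos_iff_norm m_def[symmetric] norm_scaleR by (simp add: field_simps)
  then have b: "st b = b" "norm b \<le> 1"
    using assms m by (simp_all add: b_def st_diff st_scaleR pos_def algebra_simps)
  from sqrt_exists[OF this] obtain s where
    s: "st s = s" "s * s = 1 - b" "norm (1 - s) \<le> 1" "\<And>z. z * b = b * z \<Longrightarrow> z * s = s * z" by blast
  show ?thesis
  proof
    show "pos (sqrt m *\<^sub>R s)"
      using m s(1,3) by (intro pos_scaleR pos_if_norm[where M = 1]) simp_all
    show "(sqrt m *\<^sub>R s) * (sqrt m *\<^sub>R s) = a" using m by (simp add: s(2) b_def flip: mult.assoc)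
    fix z assume "z * a = a * z"
    then have "z * s = s * z" by (intro s(4)) (simp add: b_def algebra_simps)
    then show "z * (sqrt m *\<^sub>R s) = (sqrt m *\<^sub>R s) * z" by simp
  qed
qed

text \<open>By the swap lemma \<open>- (x * st x)\<close> is positive too. Adding it to
  \<open>st x * x + x * st x\<close>, which is half a sum of two selfadjoint squares, shows that
  \<open>st x * x\<close> is positive along with its negative.\<close>

lemma eq_zero_if_neg_st_mult:
  assumes "pos (- (st x * x))" shows "x = 0"
proof -
  have "pos (- (x * st x))"
    unfolding pos_def
  proof safe
    fix t :: real assume t: "t > 0"
    have "alg_invertible (inverse t *\<^sub>R (- (st x * x) + t *\<^sub>R 1))"
      using assms t by (intro alg_invertible_scaleR) (auto simp: pos_def)
    then have "alg_invertible (1 - st x * (inverse t *\<^sub>R x))" using t by (simp add: algebra_simps)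
    then have "alg_invertible (1 - (inverse t *\<^sub>R x) * st x)"
      by (rule alg_invertible_one_minus_swap)
    then have "alg_invertible (t *\<^sub>R (1 - (inverse t *\<^sub>R x) * st x))"
      using t by (intro alg_invertible_scaleR) auto
    then show "alg_invertible (- (x * st x) + t *\<^sub>R 1)" using t by (simp add: algebra_simps)
  qed (simp add: st_minus st_mult)
  moreover have "pos (st x * x + x * st x)"
  proof -
    \<comment> \<open>Up to sign, twice the real and imaginary parts of \<open>x\<close>.\<close>
    let ?u = "x + st x" and ?v = "ci (x - st x)"
    have "?u * ?u + ?v * ?v = 2 *\<^sub>R (st x * x + x * st x)"
      by (simp add: algebra_simps cs_mult_left cs_mult_right ci_ci ci_diff scaleR_2)
    moreover have "pos (?u * ?u + ?v * ?v)"
      by (intro pos_add pos_square) (simp_all add: st_add st_ci st_diff ci_diff)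
    ultimately show ?thesis using pos_scaleR[of "?u * ?u + ?v * ?v" "1/2"] by simp
  qed
  ultimately have "pos (- (x * st x) + (st x * x + x * st x))" by (rule pos_add)
  then have "pos (st x * x)" by simp
  then have "st x * x = 0" using assms by (rule pos_antisym)
  then show ?thesis using norm_st_mult[of x] by simp
qed

text \<open>Here \<open>c = h - n\<close> with \<open>h n = 0\<close> is the Jordan decomposition; \<open>x = b n\<close> satisfies \<open>x\<^sup>* x = - n\<^sup>3\<close>,
  which forces \<open>n = 0\<close>.\<close>

lemma pos_st_mult: "pos (st b * b)"
proof -
  define c where "c = st b * b"
  have c: "st c = c" by (simp add: c_def st_mult)
  from pos_sqrt[OF pos_square[OF c]] obtain p where
    p: "pos p" "p * p = c * c" "\<And>z. z * (c * c) = c * c * z \<Longrightarrow> z * p = p * z" by blast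
  have pc: "c * p = p * c" by (rule p(3)) (simp add: mult.assoc)
  define h where "h = (1/2) *\<^sub>R (p + c)"
  define n where "n = (1/2) *\<^sub>R (p - c)"
  have hn: "h * n = 0" "n * h = 0" "h - n = c" "h + n = p"
    using pc p(2) by (simp_all add: h_def n_def algebra_simps) (simp_all flip: scaleR_add_left)
  have n: "st n = n" using c pos_herm[OF p(1)] by (simp add: n_def st_scaleR st_diff)
  have "pos n"
    unfolding pos_def
  proof safe
    fix t :: real assume t: "t > 0"
    \<comment> \<open>Since \<open>n * h = h * n = 0\<close> and \<open>h + n = p\<close>, this
      element is the product of the commuting factors \<open>n + t\<close> and
      \<open>h + t\<close>.\<close>
    have "alg_invertible (t *\<^sub>R (p + t *\<^sub>R 1))"
      using p(1) t by (intro alg_invertible_scaleR) (auto simp: pos_def)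
    also have "t *\<^sub>R (p + t *\<^sub>R 1) = (n + t *\<^sub>R 1) * (h + t *\<^sub>R 1)"
      unfolding hn(4)[symmetric] by (simp add: algebra_simps hn(1,2))
    finally show "alg_invertible (n + t *\<^sub>R 1)"
      by (rule alg_invertible_factor) (simp add: algebra_simps hn(1,2))
  qed (fact n)
  from pos_sqrt[OF this] obtain s where
    s: "pos s" "s * s = n" "\<And>z. z * n = n * z \<Longrightarrow> z * s = s * z" by blast
  have ns: "n * s = s * n" by (rule s(3)) simp
  \<comment> \<open>The cube of \<open>n\<close> is positive as the square of the selfadjoint
    \<open>n * s\<close>.\<close>
  have "n * (n * n) = (n * s) * (n * s)" by (metis ns s(2) mult.assoc)
  moreover have "pos ((n * s) * (n * s))"
    using n pos_herm[OF s(1)] ns by (intro pos_square) (simp add: st_mult)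
  ultimately have n3: "pos (n * (n * n))" by simp
  have "st (b * n) * (b * n) = n * (c * n)" by (simp add: st_mult n c_def mult.assoc)
  also have "c * n = - (n * n)" using hn by (metis diff_0 left_diff_distrib)
  finally have x: "- (st (b * n) * (b * n)) = n * (n * n)" by simp
  then have "b * n = 0" using n3 by (intro eq_zero_if_neg_st_mult) simp
  then have "n * (n * n) = 0" using x by simp
  then have "norm ((n * n) * (n * n)) = 0" by (simp add: mult.assoc)
  moreover have "norm ((n * n) * (n * n)) = (norm (n * n))\<^sup>2"
    by (rule norm_square_herm) (simp add: st_mult n)
  ultimately have "n = 0" using norm_square_herm[OF n] by simp
  then have "c = p" using hn by simp
  then show ?thesis using p(1) by (simp add: c_def)
qed

lemma pos_mult_st: "pos (a * st a)"
  using pos_st_mult[of "st a"] by simp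

lemma pos_conj: assumes "pos p" shows "pos (a * p * st a)"
proof -
  obtain s where "pos s" "s * s = p" using pos_sqrt[OF assms] by blast
  then have "a * p * st a = (a * s) * st (a * s)"
    by (auto simp: st_mult pos_herm mult.assoc)
  then show ?thesis using pos_mult_st by simp
qed

section \<open>Cauchy-Schwarz inequalities with values in the algebra\<close>

text \<open>The hypothesis is \<open>\<langle>x - t a y, x - t a y\<rangle> \<ge> 0\<close> for \<open>p = \<langle>x, x\<rangle>\<close>, \<open>a = \<langle>x, y\<rangle>\<close>, \<open>q = \<langle>y, y\<rangle>\<close>; stated
  without a module so that it also covers finite sequences and semidefinite forms.\<close>

lemma pos_Cauchy_Schwarz:
  assumes p: "\<And>t. pos (p - (2 * t) *\<^sub>R (a * st a) + (t * t) *\<^sub>R (a * q * st a))"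
    and q: "st q = q"
  shows "(norm a)\<^sup>2 \<le> norm p * norm q"
proof -
  \<comment> \<open>Taking \<open>\<beta>\<close> above \<open>norm q\<close> keeps
    \<open>inverse \<beta>\<close> meaningful even for \<open>q = 0\<close>; the limit
    \<open>\<beta> \<rightarrow> norm q\<close> from the right comes last.\<close>
  have *: "(norm a)\<^sup>2 \<le> norm p * \<beta>" if \<beta>: "\<beta> > norm q" for \<beta>
  proof -
    have \<beta>0: "\<beta> > 0" using that norm_ge_zero[of q] by linarith
    \<comment> \<open>Minimizes the coefficient \<open>t * t * \<beta> - 2 * t\<close> of
      \<open>a * st a\<close> left after replacing \<open>q\<close> by its bound
      \<open>\<beta>\<close>.\<close>
    define t where "t = inverse \<beta>"
    have "pos (\<beta> *\<^sub>R 1 - q)" using q \<beta> by (simp add: pos_scaleR_one_minus)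
    from pos_scaleR[OF pos_conj[OF this, of a], of "t * t"]
    have "pos ((t * t * \<beta>) *\<^sub>R (a * st a) - (t * t) *\<^sub>R (a * q * st a))"
      by (simp add: algebra_simps)
    from pos_add[OF p[of t] this]
    have "pos (p - (2 * t) *\<^sub>R (a * st a) + (t * t * \<beta>) *\<^sub>R (a * st a))" by simp
    also have "t * t * \<beta> = t" using \<beta>0 by (simp add: t_def)
    finally have "pos (p - t *\<^sub>R (a * st a))" by (simp add: scaleR_double)
    moreover have "pos (t *\<^sub>R (a * st a))" using \<beta>0 by (intro pos_scaleR pos_mult_st) (simp add: t_def)
    ultimately have "norm (t *\<^sub>R (a * st a)) \<le> norm p" by (rule pos_norm_mono[rotated])
    then show ?thesis using \<beta>0 by (simp add: norm_mult_st t_def field_simps)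
  qed
  have "((\<lambda>\<beta>. norm p * \<beta>) \<longlongrightarrow> norm p * norm q) (at_right (norm q))"
    by (intro tendsto_intros)
  moreover have "\<forall>\<^sub>F \<beta> in at_right (norm q). (norm a)\<^sup>2 \<le> norm p * \<beta>"
    using eventually_at_right_less by (rule eventually_mono) (rule *)
  ultimately show ?thesis by (rule tendsto_lowerbound) simp
qed

text \<open>Cauchy-Schwarz for finite sequences: the required positivity is the expansion of the
  pairing of \<open>f - t *\<^sub>R (?a * g)\<close> with itself.\<close>

lemma norm_sum_mult_st_le:
  "(norm (\<Sum>i\<in>I. f i * st (g i)))\<^sup>2 \<le> norm (\<Sum>i\<in>I. f i * st (f i)) * norm (\<Sum>i\<in>I. g i * st (g i))"
proof (rule pos_Cauchy_Schwarz)
  let ?a = "\<Sum>i\<in>I. f i * st (g i)" and ?q = "\<Sum>i\<in>I. g i * st (g i)"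
  show "st ?q = ?q" by (simp add: st_sum st_mult)
  fix t
  have sa: "st ?a = (\<Sum>i\<in>I. g i * st (f i))" by (simp add: st_sum st_mult)
  have "pos (\<Sum>i\<in>I. (f i - t *\<^sub>R (?a * g i)) * st (f i - t *\<^sub>R (?a * g i)))"
    by (intro pos_sum pos_mult_st)
  also have "(\<Sum>i\<in>I. (f i - t *\<^sub>R (?a * g i)) * st (f i - t *\<^sub>R (?a * g i)))
    = (\<Sum>i\<in>I. f i * st (f i) - t *\<^sub>R (f i * st (g i) * st ?a) - t *\<^sub>R (?a * (g i * st (f i)))
        + (t * t) *\<^sub>R (?a * (g i * st (g i)) * st ?a))"
    by (intro sum.cong refl) (simp add: st_diff st_scaleR st_mult algebra_simps)
  also have "\<dots> = (\<Sum>i\<in>I. f i * st (f i)) - t *\<^sub>R (?a * st ?a) - t *\<^sub>R (?a * st ?a)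
        + (t * t) *\<^sub>R (?a * ?q * st ?a)"
    unfolding sum.distrib sum_subtractf scaleR_sum_right[symmetric] sum_distrib_left[symmetric]
      sum_distrib_right[symmetric] sa ..
  finally show "pos ((\<Sum>i\<in>I. f i * st (f i)) - (2 * t) *\<^sub>R (?a * st ?a) + (t * t) *\<^sub>R (?a * ?q * st ?a))"
    by (simp only: scaleR_double diff_diff_eq)
qed

end

section \<open>Hilbert modules\<close>

locale hilb = cstar cs st
  for cs :: "complex \<Rightarrow> 'a::{real_normed_algebra_1,banach} \<Rightarrow> 'a" and st :: "'a \<Rightarrow> 'a" +
  fixes act :: "'a \<Rightarrow> 'h::ab_group_add \<Rightarrow> 'h" and ip :: "'h \<Rightarrow> 'h \<Rightarrow> 'a"
  assumes hilb: "hilbert_module cs st act ip"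
begin

lemmas module_axioms = hilb[unfolded hilbert_module_def]

lemmas act_add_right = module_axioms[THEN conjunct1, rule_format]
lemmas act_add_left = module_axioms[THEN conjunct2, THEN conjunct1, rule_format]
lemmas act_mult = module_axioms[THEN conjunct2, THEN conjunct2, THEN conjunct1, rule_format]
lemmas act_one [simp] = module_axioms[THEN conjunct2, THEN conjunct2, THEN conjunct2, THEN conjunct1, rule_format]
lemmas ip_add_left = module_axioms[THEN conjunct2, THEN conjunct2, THEN conjunct2, THEN conjunct2, THEN conjunct1, rule_format]
lemmas ip_act_left = module_axioms[THEN conjunct2, THEN conjunct2, THEN conjunct2, THEN conjunct2, THEN conjunct2, THEN conjunct1, rule_format]
lemmas ip_sym = module_axioms[THEN conjunct2, THEN conjunct2, THEN conjunct2, THEN conjunct2, THEN conjunct2, THEN conjunct2, THEN conjunct1, rule_format]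
lemmas cpos_ip = module_axioms[THEN conjunct2, THEN conjunct2, THEN conjunct2, THEN conjunct2, THEN conjunct2, THEN conjunct2, THEN conjunct2, THEN conjunct1, rule_format]
lemmas ip_eq_zeroD = module_axioms[THEN conjunct2, THEN conjunct2, THEN conjunct2, THEN conjunct2, THEN conjunct2, THEN conjunct2, THEN conjunct2, THEN conjunct2, THEN conjunct1, rule_format]
lemmas hcomplete = module_axioms[THEN conjunct2, THEN conjunct2, THEN conjunct2, THEN conjunct2, THEN conjunct2, THEN conjunct2, THEN conjunct2, THEN conjunct2, THEN conjunct2, rule_format]

lemma st_ip: "st (ip x y) = ip y x"
  by (rule ip_sym[symmetric])

lemma pos_ip: "pos (ip x x)"
  by (rule pos_if_cpos) (rule cpos_ip)

lemma ip_add_right: "ip x (y + z) = ip x y + ip x z"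
  by (metis st_ip st_add ip_add_left)

lemma ip_act_right: "ip x (act a y) = ip x y * st a"
  by (metis st_ip st_mult ip_act_left)

lemma ip_zero_left [simp]: "ip 0 y = 0"
  using ip_add_left[of 0 0 y] by simp

lemma ip_zero_right [simp]: "ip y 0 = 0"
  using ip_add_right[of y 0 0] by simp

lemma ip_minus_left: "ip (- x) y = - ip x y"
  using ip_add_left[of x "- x" y] by (simp add: eq_neg_iff_add_eq_0 add.commute)

lemma ip_minus_right: "ip x (- y) = - ip x y"
  using ip_add_right[of x y "- y"] by (simp add: eq_neg_iff_add_eq_0 add.commute)

lemma ip_diff_left: "ip (x - y) z = ip x z - ip y z"
  by (simp add: diff_conv_add_uminus ip_add_left ip_minus_left del: add_uminus_conv_diff)

lemma ip_diff_right: "ip x (y - z) = ip x y - ip x z"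
  by (simp add: diff_conv_add_uminus ip_add_right ip_minus_right del: add_uminus_conv_diff)

lemma ip_sum_left: "ip (\<Sum>i\<in>I. f i) y = (\<Sum>i\<in>I. ip (f i) y)"
  by (induction I rule: infinite_finite_induct) (auto simp: ip_add_left)

lemma ip_eqI: assumes "\<And>z. ip x z = ip y z" shows "x = y"
  using ip_eq_zeroD[of "x - y"] assms[of "x - y"] by (simp add: ip_diff_left)

lemma ip_eqI_right: assumes "\<And>z. ip z x = ip z y" shows "x = y"
  using arg_cong[OF assms, of st] by (intro ip_eqI) (simp add: st_ip)

lemma act_zero_right [simp]: "act a 0 = 0"
  using act_add_right[of a 0 0] by simp

lemma act_sum_right: "act a (\<Sum>i\<in>I. f i) = (\<Sum>i\<in>I. act a (f i))"
  by (induction I rule: infinite_finite_induct) (auto simp: act_add_right)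

section \<open>The module norm and positive forms\<close>

lemma hnorm_nonneg [simp]: "hnorm ip x \<ge> 0"
  by (simp add: hnorm_def)

lemma hnorm_square: "(hnorm ip x)\<^sup>2 = norm (ip x x)"
  by (simp add: hnorm_def)

lemma hnorm_zero [simp]: "hnorm ip 0 = 0"
  by (simp add: hnorm_def)

lemma hnorm_eq_zeroD: "hnorm ip x = 0 \<Longrightarrow> x = 0"
  by (auto simp: hnorm_def ip_eq_zeroD)

lemma hnorm_minus: "hnorm ip (- x) = hnorm ip x"
  by (simp add: hnorm_def ip_minus_left ip_minus_right)

lemma hnorm_minus_commute: "hnorm ip (x - y) = hnorm ip (y - x)"
  using hnorm_minus[of "x - y"] by simp

lemma hnorm_act: "hnorm ip (act a x) \<le> norm a * hnorm ip x"
proof (rule power2_le_imp_le)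
  have "(hnorm ip (act a x))\<^sup>2 = norm (a * (ip x x * st a))"
    by (simp add: hnorm_square ip_act_left ip_act_right mult.assoc)
  also have "\<dots> \<le> norm a * norm (ip x x * st a)" by (rule norm_mult_ineq)
  also have "\<dots> \<le> norm a * (norm (ip x x) * norm (st a))"
    by (intro mult_left_mono norm_mult_ineq norm_ge_zero)
  also have "\<dots> = (norm a * hnorm ip x)\<^sup>2"
    unfolding power_mult_distrib hnorm_square by (simp add: power2_eq_square)
  finally show "(hnorm ip (act a x))\<^sup>2 \<le> (norm a * hnorm ip x)\<^sup>2" .
qed simp

text \<open>The form of a positive operator may be degenerate. Uses: the identity,
  \<open>1 - S/D\<close> for invertibility of the frame operator, and \<open>S - 1\<close> for
  normalized tight frames.\<close>

lemma form_Cauchy_Schwarz: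
  assumes R: "\<And>x y. R (x + y) = R x + R y" "\<And>a x. R (act a x) = act a (R x)"
    "\<And>x y. ip (R x) y = ip x (R y)" "\<And>x. pos (ip (R x) x)"
  shows "(norm (ip (R x) y))\<^sup>2 \<le> norm (ip (R x) x) * norm (ip (R y) y)"
proof (rule pos_Cauchy_Schwarz)
  let ?a = "ip (R x) y"
  have sym: "st (ip (R u) v) = ip (R v) u" for u v by (simp only: R(3) st_ip)
  show "st (ip (R y) y) = ip (R y) y" by (rule sym)
  fix t
  \<comment> \<open>With this vector the form at \<open>x + ?z\<close> becomes the quadratic in
    \<open>t\<close> that \<open>pos_Cauchy_Schwarz\<close> expects.\<close>
  let ?z = "act (- (t *\<^sub>R ?a)) y"
  have "pos (ip (R (x + ?z)) (x + ?z))" by (rule R(4))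
  moreover have "ip (R (x + ?z)) (x + ?z)
     = ip (R x) x - (2 * t) *\<^sub>R (?a * st ?a) + (t * t) *\<^sub>R (?a * ip (R y) y * st ?a)"
    by (simp add: R(1,2) ip_add_left ip_add_right ip_act_left ip_act_right st_minus st_scaleR
        sym scaleR_double algebra_simps)
  ultimately show "pos (ip (R x) x - (2 * t) *\<^sub>R (?a * st ?a) + (t * t) *\<^sub>R (?a * ip (R y) y * st ?a))"
    by simp
qed

lemma Cauchy_Schwarz: "norm (ip x y) \<le> hnorm ip x * hnorm ip y"
proof (rule power2_le_imp_le)
  have "(norm (ip x y))\<^sup>2 \<le> norm (ip x x) * norm (ip y y)"
    by (rule form_Cauchy_Schwarz[of "\<lambda>x. x"]) (rule refl pos_ip)+
  then show "(norm (ip x y))\<^sup>2 \<le> (hnorm ip x * hnorm ip y)\<^sup>2"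
    by (simp add: hnorm_square power_mult_distrib)
qed simp

lemma hnorm_triangle: "hnorm ip (x + y) \<le> hnorm ip x + hnorm ip y"
proof (rule power2_le_imp_le)
  have "(hnorm ip (x + y))\<^sup>2 = norm ((ip x x + ip x y) + (ip y x + ip y y))"
    by (simp add: hnorm_square ip_add_left ip_add_right algebra_simps)
  also have "\<dots> \<le> (norm (ip x x) + norm (ip x y)) + (norm (ip y x) + norm (ip y y))"
    by (intro norm_triangle_mono norm_triangle_ineq)
  also have "\<dots> \<le> (hnorm ip x + hnorm ip y)\<^sup>2"
    using Cauchy_Schwarz[of x y] Cauchy_Schwarz[of y x]
    unfolding power2_sum hnorm_square by (simp add: algebra_simps)
  finally show "(hnorm ip (x + y))\<^sup>2 \<le> (hnorm ip x + hnorm ip y)\<^sup>2" .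
qed simp

lemma hnorm_triangle_diff: "hnorm ip (x - z) \<le> hnorm ip (x - y) + hnorm ip (y - z)"
  using hnorm_triangle[of "x - y" "y - z"] by simp

section \<open>Convergence in the module norm and fixed points\<close>

lemma hconv_bounded:
  assumes "\<And>n. hnorm ip (f n - l) \<le> g n" "g \<longlonglongrightarrow> 0"
  shows "hconv ip f l"
  unfolding hconv_def
proof (rule Lim_null_comparison[OF _ assms(2)])
  show "\<forall>\<^sub>F n in sequentially. norm (hnorm ip (f n - l)) \<le> g n"
    using assms(1) by simp
qed

lemma hconv_unique:
  assumes "hconv ip f l" "hconv ip f m" shows "l = m"
proof -
  have lim: "(\<lambda>n. hnorm ip (f n - l) + hnorm ip (f n - m)) \<longlonglongrightarrow> 0 + 0"
    using assms unfolding hconv_def by (rule tendsto_add)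
  have "hnorm ip (l - m) \<le> hnorm ip (f n - l) + hnorm ip (f n - m)" for n
    using hnorm_triangle_diff[of l m "f n"] by (simp add: hnorm_minus_commute[of l "f n"])
  then have "hnorm ip (l - m) \<le> 0 + 0" by (intro LIMSEQ_le_const[OF lim] exI allI impI)
  then have "hnorm ip (l - m) = 0" using hnorm_nonneg[of "l - m"] by linarith
  then have "l - m = 0" by (rule hnorm_eq_zeroD)
  then show ?thesis by simp
qed

lemma hconv_add:
  assumes "hconv ip f l" "hconv ip g m" shows "hconv ip (\<lambda>n. f n + g n) (l + m)"
proof (rule hconv_bounded)
  show "(\<lambda>n. hnorm ip (f n - l) + hnorm ip (g n - m)) \<longlonglongrightarrow> 0"
    using tendsto_add[OF assms[unfolded hconv_def]] by simp
  show "hnorm ip (f n + g n - (l + m)) \<le> hnorm ip (f n - l) + hnorm ip (g n - m)" for n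
    using hnorm_triangle[of "f n - l" "g n - m"] by (simp add: algebra_simps)
qed

lemma hconv_act: assumes "hconv ip f l" shows "hconv ip (\<lambda>n. act a (f n)) (act a l)"
proof (rule hconv_bounded)
  show "(\<lambda>n. norm a * hnorm ip (f n - l)) \<longlonglongrightarrow> 0"
    using assms unfolding hconv_def by (rule tendsto_mult_right_zero)
  fix n
  have "act a (f n) = act a (f n - l) + act a l" by (simp flip: act_add_right)
  then show "hnorm ip (act a (f n) - act a l) \<le> norm a * hnorm ip (f n - l)"
    using hnorm_act[of a "f n - l"] by simp
qed

lemma hconv_ip: assumes "hconv ip f l" shows "(\<lambda>n. ip (f n) y) \<longlonglongrightarrow> ip l y"
proof -
  have "(\<lambda>n. ip (f n) y - ip l y) \<longlonglongrightarrow> 0"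
  proof (rule Lim_null_comparison)
    show "(\<lambda>n. hnorm ip (f n - l) * hnorm ip y) \<longlonglongrightarrow> 0"
      using assms unfolding hconv_def by (rule tendsto_mult_left_zero)
    show "\<forall>\<^sub>F n in sequentially. norm (ip (f n) y - ip l y) \<le> hnorm ip (f n - l) * hnorm ip y"
      using Cauchy_Schwarz by (simp flip: ip_diff_left)
  qed
  then show ?thesis by (rule LIM_zero_cancel)
qed

lemma hconv_hnorm_le:
  assumes "hconv ip f l" "\<And>n. hnorm ip (f n) \<le> B" shows "hnorm ip l \<le> B"
proof -
  have *: "hnorm ip l \<le> B + hnorm ip (f n - l)" for n
    using hnorm_triangle[of "f n" "l - f n"] assms(2)[of n] by (simp add: hnorm_minus_commute[of l "f n"])
  have "(\<lambda>n. B + hnorm ip (f n - l)) \<longlonglongrightarrow> B + 0"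
    using assms(1) unfolding hconv_def by (intro tendsto_intros)
  from LIMSEQ_le_const[OF this, of "hnorm ip l"] show ?thesis using * by auto
qed

text \<open>Banach's fixed-point theorem for \<open>hnorm ip\<close>: the iterates from
  \<open>0\<close> are Cauchy, and \<open>hcomplete\<close> supplies the limit.\<close>

lemma contraction_fixpoint:
  assumes R: "\<And>x y. hnorm ip (R x - R y) \<le> \<rho> * hnorm ip (x - y)" and \<rho>: "0 \<le> \<rho>" "\<rho> < 1"
  shows "\<exists>x. R x = x"
proof -
  define u where "u n = (R ^^ n) 0" for n
  have u: "u (Suc n) = R (u n)" for n by (simp add: u_def)
  define d where "d = hnorm ip (u 1 - u 0)"
  have step: "hnorm ip (u (Suc n) - u n) \<le> \<rho> ^ n * d" for n
  proof (induction n)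
    case (Suc n)
    have "hnorm ip (u (Suc (Suc n)) - u (Suc n)) \<le> \<rho> * hnorm ip (u (Suc n) - u n)"
      unfolding u(1)[of "Suc n"] by (subst (2) u) (rule R)
    also have "\<dots> \<le> \<rho> * (\<rho> ^ n * d)" using Suc \<rho> by (intro mult_left_mono)
    finally show ?case by (simp add: mult.assoc)
  qed (simp add: d_def)
  \<comment> \<open>The geometric sum of \<open>step\<close>, multiplied through by
    \<open>1 - \<rho>\<close> so that the induction stays free of division.\<close>
  have tail: "(1 - \<rho>) * hnorm ip (u (n + k) - u n) \<le> \<rho> ^ n * d * (1 - \<rho> ^ k)" for n k
  proof (induction k)
    case (Suc k)
    have "hnorm ip (u (n + Suc k) - u n) \<le> \<rho> ^ (n + k) * d + hnorm ip (u (n + k) - u n)"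
      using hnorm_triangle_diff[of "u (n + Suc k)" "u n" "u (n + k)"] step[of "n + k"] by simp
    then have "(1 - \<rho>) * hnorm ip (u (n + Suc k) - u n)
        \<le> (1 - \<rho>) * (\<rho> ^ (n + k) * d + hnorm ip (u (n + k) - u n))"
      using \<rho> by (intro mult_left_mono) auto
    also have "\<dots> \<le> (1 - \<rho>) * (\<rho> ^ (n + k) * d) + \<rho> ^ n * d * (1 - \<rho> ^ k)"
      using Suc by (simp add: distrib_left)
    also have "\<dots> = \<rho> ^ n * d * (1 - \<rho> ^ Suc k)" by (simp add: algebra_simps power_add)
    finally show ?case .
  qed simp
  \<comment> \<open>The factor 2 comes from passing through \<open>u N\<close>, which treats both
    orders of \<open>m\<close> and \<open>n\<close> alike.\<close>
  have bnd: "hnorm ip (u m - u n) \<le> 2 * (\<rho> ^ N * (d / (1 - \<rho>)))" if "m \<ge> N" "n \<ge> N" for m n N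
  proof -
    have *: "hnorm ip (u m - u N) \<le> \<rho> ^ N * (d / (1 - \<rho>))" if "m \<ge> N" for m
    proof -
      have "(1 - \<rho>) * hnorm ip (u m - u N) \<le> \<rho> ^ N * d * (1 - \<rho> ^ (m - N))"
        using tail[of N "m - N"] that by simp
      also have "\<dots> \<le> \<rho> ^ N * d * 1"
        using \<rho> by (intro mult_left_mono) (auto simp: d_def)
      finally show ?thesis using \<rho> by (simp add: field_simps)
    qed
    show ?thesis
      using hnorm_triangle_diff[of "u m" "u n" "u N"] *[OF that(1)] *[OF that(2)]
      unfolding hnorm_minus_commute[of "u N" "u n"] by linarith
  qed
  have lim: "(\<lambda>N. 2 * (\<rho> ^ N * (d / (1 - \<rho>)))) \<longlonglongrightarrow> 0"
    using \<rho> by (intro tendsto_mult_right_zero tendsto_mult_left_zero LIMSEQ_realpow_zero) auto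
  have "\<exists>l. hconv ip u l"
  proof (rule hcomplete)
    fix e :: real assume "0 < e"
    then obtain N where "2 * (\<rho> ^ N * (d / (1 - \<rho>))) < e"
      using order_tendstoD(2)[OF lim] eventually_happens'[OF sequentially_bot] by blast
    then show "\<exists>N. \<forall>m\<ge>N. \<forall>n\<ge>N. hnorm ip (u m - u n) < e" using bnd by (meson le_less_trans)
  qed
  then obtain l where l: "hconv ip u l" by blast
  have "hconv ip (\<lambda>n. u (Suc n)) (R l)"
  proof (rule hconv_bounded)
    show "hnorm ip (u (Suc n) - R l) \<le> \<rho> * hnorm ip (u n - l)" for n unfolding u by (rule R)
    show "(\<lambda>n. \<rho> * hnorm ip (u n - l)) \<longlonglongrightarrow> 0"
      using l unfolding hconv_def by (rule tendsto_mult_right_zero)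
  qed
  moreover have "hconv ip (\<lambda>n. u (Suc n)) l"
    using l unfolding hconv_def by (rule LIMSEQ_Suc)
  ultimately show ?thesis using hconv_unique by blast
qed

end

section \<open>Frames\<close>

lemma psum_diff:
  fixes f :: "nat \<Rightarrow> 'b::ab_group_add"
  assumes "n \<le> m"
  shows "psum J f m - psum J f n = (\<Sum>j\<in>J \<inter> {n..<m}. f j)"
proof -
  have "(\<Sum>j\<in>J \<inter> {..<m}. f j) - (\<Sum>j\<in>J \<inter> {..<n}. f j) = (\<Sum>j\<in>J \<inter> {..<m} - J \<inter> {..<n}. f j)"
    using assms by (intro sum_diff[symmetric]) auto
  moreover have "J \<inter> {..<m} - J \<inter> {..<n} = J \<inter> {n..<m}" by auto
  ultimately show ?thesis by (simp only: psum_def)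
qed

section \<open>Analysis and synthesis for one frame\<close>

locale frame = hilb cs st act ip
  for cs :: "complex \<Rightarrow> 'a::{real_normed_algebra_1,banach} \<Rightarrow> 'a" and st :: "'a \<Rightarrow> 'a"
    and act :: "'a \<Rightarrow> 'h::ab_group_add \<Rightarrow> 'h" and ip :: "'h \<Rightarrow> 'h \<Rightarrow> 'a" +
  fixes J :: "nat set" and xs :: "nat \<Rightarrow> 'h"
  assumes frame: "standard_frame cs st ip J xs"
begin

text \<open>The frame transform before it is set to zero outside \<open>J\<close>;
  \<open>psum J\<close> sees no difference.\<close>

definition an :: "'h \<Rightarrow> nat \<Rightarrow> 'a" where "an x j = ip x (xs j)"

definition l2 :: "(nat \<Rightarrow> 'a) \<Rightarrow> bool" where
  "l2 c \<longleftrightarrow> convergent (psum J (\<lambda>j. c j * st (c j)))"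

text \<open>Arbitrary unless the series converges, which \<open>l2 c\<close> guarantees.\<close>

definition syn :: "(nat \<Rightarrow> 'a) \<Rightarrow> 'h" where
  "syn c = (SOME l. hconv ip (psum J (\<lambda>j. act (c j) (xs j))) l)"

lemma st_an: "st (an x j) = ip (xs j) x"
  by (simp add: an_def st_ip)

lemma frame_bounds:
  obtains C D where "0 < C" "C \<le> D"
    "\<And>x. \<exists>s. psum J (\<lambda>j. an x j * st (an x j)) \<longlonglongrightarrow> s
       \<and> pos (s - C *\<^sub>R ip x x) \<and> pos (D *\<^sub>R ip x x - s)"
proof -
  obtain C D where CD: "C > 0" "D > 0" and
    fr: "\<forall>x. \<exists>s. psum J (\<lambda>j. ip x (xs j) * ip (xs j) x) \<longlonglongrightarrow> s \<and>
           cle cs st (C *\<^sub>R ip x x) s \<and> cle cs st s (D *\<^sub>R ip x x)"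
    using frame unfolding standard_frame_def by (elim exE conjE)
  show ?thesis
  \<comment> \<open>The maximum ensures \<open>C \<le> D\<close> even on the zero module; this later
    keeps the contraction constant nonnegative.\<close>
  proof (rule that[of C "max C D"])
    fix x
    obtain s where s: "psum J (\<lambda>j. ip x (xs j) * ip (xs j) x) \<longlonglongrightarrow> s"
      and cle: "cle cs st (C *\<^sub>R ip x x) s" "cle cs st s (D *\<^sub>R ip x x)"
      using fr[rule_format, of x] by (elim exE conjE)
    have ps: "pos (s - C *\<^sub>R ip x x)" "pos (D *\<^sub>R ip x x - s)"
      using cle unfolding cle_def by (simp_all only: pos_if_cpos)
    have "pos ((max C D - D) *\<^sub>R ip x x)" by (intro pos_scaleR pos_ip) simp
    from pos_add[OF ps(2) this] have "pos (max C D *\<^sub>R ip x x - s)" by (simp add: algebra_simps)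
    then show "\<exists>s. psum J (\<lambda>j. an x j * st (an x j)) \<longlonglongrightarrow> s
       \<and> pos (s - C *\<^sub>R ip x x) \<and> pos (max C D *\<^sub>R ip x x - s)"
      using s ps(1) unfolding st_an unfolding an_def by (intro exI[of _ s] conjI)
  qed (use CD in auto)
qed

lemma l2_an: "l2 (an x)"
proof -
  obtain C D where CD: "0 < C" "C \<le> D" "\<And>x. \<exists>s. psum J (\<lambda>j. an x j * st (an x j)) \<longlonglongrightarrow> s
       \<and> pos (s - C *\<^sub>R ip x x) \<and> pos (D *\<^sub>R ip x x - s)"
    by (rule frame_bounds) blast
  show ?thesis unfolding l2_def convergent_def using CD(3)[of x] by blast
qed

text \<open>The terms outside \<open>F\<close> are positive, so a finite sum lies below the limit of
  the series; monotonicity of the norm turns this into a bound.\<close>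

lemma Bessel:
  obtains D where "0 < D"
    "\<And>F x. finite F \<Longrightarrow> F \<subseteq> J \<Longrightarrow> norm (\<Sum>j\<in>F. an x j * st (an x j)) \<le> D * (hnorm ip x)\<^sup>2"
proof -
  obtain C D where CD: "0 < C" "C \<le> D"
    "\<And>x. \<exists>s. psum J (\<lambda>j. an x j * st (an x j)) \<longlonglongrightarrow> s
       \<and> pos (s - C *\<^sub>R ip x x) \<and> pos (D *\<^sub>R ip x x - s)"
    by (rule frame_bounds) blast
  show ?thesis
  proof (rule that[of D])
    fix F x assume F: "finite F" "F \<subseteq> J"
    let ?f = "\<lambda>j. an x j * st (an x j)"
    obtain s where s: "psum J ?f \<longlonglongrightarrow> s" "pos (D *\<^sub>R ip x x - s)" using CD(3) by blast
    obtain N where N: "F \<subseteq> {..<N}" using F(1) finite_nat_iff_bounded by blast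
    have "pos (s - sum ?f F)"
    proof (rule pos_tendsto)
      show "(\<lambda>n. psum J ?f (n + N) - sum ?f F) \<longlonglongrightarrow> s - sum ?f F"
        by (intro tendsto_intros LIMSEQ_ignore_initial_segment s)
      fix n
      have "psum J ?f (n + N) - sum ?f F = sum ?f (J \<inter> {..<n + N} - F)"
        unfolding psum_def using F N by (intro sum_diff[symmetric]) force+
      then show "pos (psum J ?f (n + N) - sum ?f F)" by (simp add: pos_sum pos_mult_st)
    qed
    from pos_add[OF s(2) this] have "pos (D *\<^sub>R ip x x - sum ?f F)" by simp
    from pos_norm_mono[OF _ this] have "norm (sum ?f F) \<le> norm (D *\<^sub>R ip x x)"
      by (simp add: pos_sum pos_mult_st)
    then show "norm (sum ?f F) \<le> D * (hnorm ip x)\<^sup>2" using CD by (simp add: hnorm_square)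
  qed (use CD in auto)
qed

text \<open>Dual to \<open>Bessel\<close>: \<open>ip z z\<close> pairs \<open>c\<close> with the
  coefficients of \<open>z\<close>, so Cauchy-Schwarz gives \<open>w * w \<le> (D * Q) * w\<close>,
  and \<open>w\<close> cancels.\<close>

lemma synthesis_bound:
  obtains D where "0 < D"
    "\<And>F c. finite F \<Longrightarrow> F \<subseteq> J \<Longrightarrow>
       (hnorm ip (\<Sum>j\<in>F. act (c j) (xs j)))\<^sup>2 \<le> D * norm (\<Sum>j\<in>F. c j * st (c j))"
proof -
  obtain D where D: "0 < D"
    "\<And>F x. finite F \<Longrightarrow> F \<subseteq> J \<Longrightarrow> norm (\<Sum>j\<in>F. an x j * st (an x j)) \<le> D * (hnorm ip x)\<^sup>2"
    by (rule Bessel) blast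
  show ?thesis
  proof (rule that[OF D(1)])
    fix F and c :: "nat \<Rightarrow> 'a" assume F: "finite F" "F \<subseteq> J"
    define z where "z = (\<Sum>j\<in>F. act (c j) (xs j))"
    define Q where "Q = norm (\<Sum>j\<in>F. c j * st (c j))"
    define w where "w = (hnorm ip z)\<^sup>2"
    have w: "w \<ge> 0" by (simp add: w_def)
    have "ip z z = (\<Sum>j\<in>F. c j * st (an z j))"
      by (subst z_def) (simp add: ip_sum_left ip_act_left st_an)
    then have "w\<^sup>2 \<le> Q * norm (\<Sum>j\<in>F. an z j * st (an z j))"
      using norm_sum_mult_st_le[of c "an z" F] by (simp add: w_def hnorm_square Q_def)
    also have "\<dots> \<le> Q * (D * w)" unfolding w_def using D(2)[OF F] by (intro mult_left_mono) (simp_all add: Q_def)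
    finally have *: "w * w \<le> (D * Q) * w" by (simp add: power2_eq_square mult_ac)
    have "w \<le> D * Q"
    proof (cases "w = 0")
      case True then show ?thesis using D(1) by (simp add: Q_def)
    next
      case False then show ?thesis using * w by (simp add: mult_le_cancel_right)
    qed
    then show "(hnorm ip (\<Sum>j\<in>F. act (c j) (xs j)))\<^sup>2 \<le> D * norm (\<Sum>j\<in>F. c j * st (c j))"
      by (simp add: w_def z_def Q_def)
  qed
qed

text \<open>Applied to blocks \<open>J \<inter> {n..<m}\<close>, \<open>synthesis_bound\<close>
  carries the Cauchy property from the sums of \<open>c j * st (c j)\<close> to the module.\<close>

lemma synthesis_converges:
  assumes "l2 c" shows "\<exists>l. hconv ip (psum J (\<lambda>j. act (c j) (xs j))) l"
proof (rule hcomplete)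
  obtain D where D: "0 < D"
    "\<And>F c. finite F \<Longrightarrow> F \<subseteq> J \<Longrightarrow>
       (hnorm ip (\<Sum>j\<in>F. act (c j) (xs j)))\<^sup>2 \<le> D * norm (\<Sum>j\<in>F. c j * st (c j))"
    by (rule synthesis_bound) blast
  let ?P = "psum J (\<lambda>j. act (c j) (xs j))" and ?Q = "psum J (\<lambda>j. c j * st (c j))"
  fix e :: real assume e: "0 < e"
  have "Cauchy ?Q" using assms unfolding l2_def by (rule convergent_Cauchy)
  moreover have "0 < e\<^sup>2 / D" using e D(1) by simp
  ultimately obtain N where N: "\<forall>m\<ge>N. \<forall>n\<ge>N. norm (?Q m - ?Q n) < e\<^sup>2 / D"
    using CauchyD by blast
  have *: "hnorm ip (?P m - ?P n) < e" if nm: "N \<le> n" "n \<le> m" for m n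
  proof -
    have fin: "finite (J \<inter> {n..<m})" "J \<inter> {n..<m} \<subseteq> J" by auto
    have 1: "(hnorm ip (?P m - ?P n))\<^sup>2 \<le> D * norm (?Q m - ?Q n)"
      unfolding psum_diff[OF nm(2)] by (rule D(2)[OF fin])
    have "N \<le> m" using nm by (rule order.trans)
    then have "norm (?Q m - ?Q n) < e\<^sup>2 / D" using N nm(1) by blast
    then have "D * norm (?Q m - ?Q n) < D * (e\<^sup>2 / D)"
      using D(1) by (rule mult_strict_left_mono)
    with 1 have "(hnorm ip (?P m - ?P n))\<^sup>2 < e\<^sup>2" using D(1) by simp
    then show ?thesis by (rule power2_less_imp_less) (use e in simp)
  qed
  show "\<exists>N. \<forall>m\<ge>N. \<forall>n\<ge>N. hnorm ip (?P m - ?P n) < e"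
  proof (intro exI[of _ N] allI impI)
    fix m n assume m: "N \<le> m" and n: "N \<le> n"
    show "hnorm ip (?P m - ?P n) < e"
    proof (cases "n \<le> m")
      case True
      with n show ?thesis by (rule *)
    next
      case False
      then have "hnorm ip (?P n - ?P m) < e" by (intro *[OF m]) simp
      then show ?thesis by (simp only: hnorm_minus_commute[of "?P m" "?P n"])
    qed
  qed
qed

lemma hconv_syn: "l2 c \<Longrightarrow> hconv ip (psum J (\<lambda>j. act (c j) (xs j))) (syn c)"
  unfolding syn_def by (rule someI_ex) (rule synthesis_converges)

lemma syn_eqI: "l2 c \<Longrightarrow> hconv ip (psum J (\<lambda>j. act (c j) (xs j))) l \<Longrightarrow> syn c = l"
  using hconv_syn hconv_unique by blast

lemma ip_syn: 
  assumes "l2 c" shows "psum J (\<lambda>j. c j * ip (xs j) y) \<longlonglongrightarrow> ip (syn c) y"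
  using hconv_ip[OF hconv_syn[OF assms], of y]
  by (simp add: psum_def[abs_def] ip_sum_left ip_act_left)

lemma syn_add:
  assumes "l2 c" "l2 d" "l2 (\<lambda>j. c j + d j)"
  shows "syn (\<lambda>j. c j + d j) = syn c + syn d"
proof (rule syn_eqI[OF assms(3)])
  have "psum J (\<lambda>j. act (c j + d j) (xs j)) =
     (\<lambda>n. psum J (\<lambda>j. act (c j) (xs j)) n + psum J (\<lambda>j. act (d j) (xs j)) n)"
    by (simp add: fun_eq_iff psum_def act_add_left sum.distrib)
  then show "hconv ip (psum J (\<lambda>j. act (c j + d j) (xs j))) (syn c + syn d)"
    using hconv_add[OF hconv_syn[OF assms(1)] hconv_syn[OF assms(2)]] by simp
qed

lemma syn_act:
  assumes "l2 c" "l2 (\<lambda>j. a * c j)"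
  shows "syn (\<lambda>j. a * c j) = act a (syn c)"
proof (rule syn_eqI[OF assms(2)])
  have "psum J (\<lambda>j. act (a * c j) (xs j)) = (\<lambda>n. act a (psum J (\<lambda>j. act (c j) (xs j)) n))"
    by (simp add: fun_eq_iff psum_def act_mult act_sum_right)
  then show "hconv ip (psum J (\<lambda>j. act (a * c j) (xs j))) (act a (syn c))"
    using hconv_act[OF hconv_syn[OF assms(1)]] by simp
qed

lemma an_add: "an (x + y) = (\<lambda>j. an x j + an y j)"
  and an_act: "an (act a x) = (\<lambda>j. a * an x j)"
  by (simp_all add: an_def fun_eq_iff ip_add_left ip_act_left)

end

section \<open>Two frames over one index set and the operator \<open>G\<close> between their
  modules\<close>

locale frame_pair = cstar cs st + F1: frame cs st act1 ip1 J xs + F2: frame cs st act2 ip2 J ys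
  for cs :: "complex \<Rightarrow> 'a::{real_normed_algebra_1,banach} \<Rightarrow> 'a" and st :: "'a \<Rightarrow> 'a"
    and act1 :: "'a \<Rightarrow> 'h1::ab_group_add \<Rightarrow> 'h1" and ip1 :: "'h1 \<Rightarrow> 'h1 \<Rightarrow> 'a"
    and act2 :: "'a \<Rightarrow> 'h2::ab_group_add \<Rightarrow> 'h2" and ip2 :: "'h2 \<Rightarrow> 'h2 \<Rightarrow> 'a"
    and J :: "nat set" and xs :: "nat \<Rightarrow> 'h1" and ys :: "nat \<Rightarrow> 'h2"
begin

lemma l2_F1 [simp]: "F2.l2 (F1.an x)"
  using F1.l2_an unfolding F1.l2_def F2.l2_def .

lemma l2_F2 [simp]: "F1.l2 (F2.an x)"
  using F2.l2_an unfolding F1.l2_def F2.l2_def .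

definition G :: "'h1 \<Rightarrow> 'h2" where "G x = F2.syn (F1.an x)"
definition G' :: "'h2 \<Rightarrow> 'h1" where "G' y = F1.syn (F2.an y)"

lemma ip_G: "psum J (\<lambda>j. ip1 x (xs j) * ip2 (ys j) y) \<longlonglongrightarrow> ip2 (G x) y"
  unfolding G_def using F2.ip_syn[of "F1.an x" y] by (simp add: F1.an_def)

lemma ip_G': "psum J (\<lambda>j. ip2 y (ys j) * ip1 (xs j) x) \<longlonglongrightarrow> ip1 (G' y) x"
  unfolding G'_def using F1.ip_syn[of "F2.an y" x] by (simp add: F2.an_def)

text \<open>Applying \<open>st\<close> termwise to the series for \<open>ip1 (G' y) x\<close> gives
  the series for \<open>ip2 (G x) y\<close>.\<close>

lemma G_adjoint: "ip2 (G x) y = ip1 x (G' y)"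
proof -
  have "(\<lambda>N. st (psum J (\<lambda>j. ip2 y (ys j) * ip1 (xs j) x) N)) \<longlonglongrightarrow> st (ip1 (G' y) x)"
    by (rule st_tendsto) (rule ip_G')
  then have "psum J (\<lambda>j. ip1 x (xs j) * ip2 (ys j) y) \<longlonglongrightarrow> ip1 x (G' y)"
    by (simp add: psum_def[abs_def] st_sum st_mult F1.st_ip F2.st_ip)
  then show ?thesis using ip_G LIMSEQ_unique by blast
qed

lemma G_add: "G (x + y) = G x + G y"
  unfolding G_def F1.an_add by (rule F2.syn_add) (simp_all flip: F1.an_add)

lemma G_act: "G (act1 a x) = act2 a (G x)"
  unfolding G_def F1.an_act by (rule F2.syn_act) (simp_all flip: F1.an_act)

text \<open>\<open>Bessel\<close> for \<open>xs\<close> and \<open>synthesis_bound\<close> for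
  \<open>ys\<close> bound all partial sums alike, hence their limit.\<close>

lemma G_bounded: "\<exists>K\<ge>0. \<forall>x. hnorm ip2 (G x) \<le> K * hnorm ip1 x"
proof -
  obtain D1 where D1: "0 < D1"
    "\<And>F x. finite F \<Longrightarrow> F \<subseteq> J \<Longrightarrow> norm (\<Sum>j\<in>F. F1.an x j * st (F1.an x j)) \<le> D1 * (hnorm ip1 x)\<^sup>2"
    by (rule F1.Bessel) blast
  obtain D2 where D2: "0 < D2"
    "\<And>F c. finite F \<Longrightarrow> F \<subseteq> J \<Longrightarrow>
       (hnorm ip2 (\<Sum>j\<in>F. act2 (c j) (ys j)))\<^sup>2 \<le> D2 * norm (\<Sum>j\<in>F. c j * st (c j))"
    by (rule F2.synthesis_bound) blast
  have "hnorm ip2 (G x) \<le> sqrt (D2 * D1) * hnorm ip1 x" for x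
  proof (rule F2.hconv_hnorm_le)
    show "hconv ip2 (psum J (\<lambda>j. act2 (F1.an x j) (ys j))) (G x)"
      unfolding G_def by (rule F2.hconv_syn) simp
    fix N
    let ?z = "psum J (\<lambda>j. act2 (F1.an x j) (ys j)) N"
    have fin: "finite (J \<inter> {..<N})" "J \<inter> {..<N} \<subseteq> J" by auto
    have "(hnorm ip2 ?z)\<^sup>2 \<le> D2 * norm (\<Sum>j\<in>J \<inter> {..<N}. F1.an x j * st (F1.an x j))"
      unfolding psum_def by (rule D2(2)[OF fin])
    also have "\<dots> \<le> D2 * (D1 * (hnorm ip1 x)\<^sup>2)"
      by (rule mult_left_mono[OF D1(2)[OF fin]]) (use D2(1) in simp)
    also have "\<dots> = (sqrt (D2 * D1) * hnorm ip1 x)\<^sup>2"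
      using D1(1) D2(1) by (simp add: power_mult_distrib)
    finally show "hnorm ip2 ?z \<le> sqrt (D2 * D1) * hnorm ip1 x"
      by (rule power2_le_imp_le) (use D1(1) D2(1) in simp)
  qed
  then show ?thesis using D1(1) D2(1) by (intro exI[of _ "sqrt (D2 * D1)"]) auto
qed

end

section \<open>The frame operator and its inverse\<close>

context frame
begin

text \<open>The frame operator is \<open>G\<close> for a frame paired with itself, which yields its
  linearity and symmetry.\<close>

interpretation self: frame_pair cs st act ip act ip J xs xs
  by unfold_locales

definition S :: "'h \<Rightarrow> 'h" where "S x = syn (an x)"

lemma self_G: "self.G = S" "self.G' = S"
  by (simp_all add: fun_eq_iff S_def self.G_def self.G'_def)

lemma S_add: "S (x + y) = S x + S y"
  and S_act: "S (act a x) = act a (S x)"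
  and S_adjoint: "ip (S x) y = ip x (S y)"
  using self.G_add self.G_act self.G_adjoint unfolding self_G by blast+

lemma S_diff: "S (x - y) = S x - S y"
  using S_add[of "x - y" y] by simp

lemma ip_S: "psum J (\<lambda>j. an x j * st (an x j)) \<longlonglongrightarrow> ip (S x) x"
  using self.ip_G[of x x] unfolding self_G st_an unfolding an_def .

lemma S_bounds:
  obtains C D where "0 < C" "C \<le> D"
    "\<And>x. pos (ip (S x) x - C *\<^sub>R ip x x)" "\<And>x. pos (D *\<^sub>R ip x x - ip (S x) x)"
proof -
  obtain C D where CD: "0 < C" "C \<le> D"
    "\<And>x. \<exists>s. psum J (\<lambda>j. an x j * st (an x j)) \<longlonglongrightarrow> s
       \<and> pos (s - C *\<^sub>R ip x x) \<and> pos (D *\<^sub>R ip x x - s)"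
    by (rule frame_bounds) blast
  have "pos (ip (S x) x - C *\<^sub>R ip x x) \<and> pos (D *\<^sub>R ip x x - ip (S x) x)" for x
    using CD(3)[of x] LIMSEQ_unique[OF ip_S] by auto
  then show ?thesis using that CD(1,2) by blast
qed

text \<open>A solution of \<open>S x = z\<close> is a fixed point of
  \<open>x \<mapsto> r z + R x\<close> with \<open>R = 1 - r S\<close>; the frame bounds place the
  form of \<open>R\<close> between \<open>0\<close> and \<open>\<rho>\<close> times the inner
  product.\<close>

lemma S_surj: "\<exists>x. S x = z"
proof -
  obtain C D where CD: "0 < C" "C \<le> D"
    "\<And>x. pos (ip (S x) x - C *\<^sub>R ip x x)" "\<And>x. pos (D *\<^sub>R ip x x - ip (S x) x)"
    by (rule S_bounds) blast
  define r where "r = inverse D"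
  \<comment> \<open>That is \<open>1 - C / D\<close>, at least 0 because \<open>C \<le> D\<close>
    and below 1 because \<open>C > 0\<close>.\<close>
  define \<rho> where "\<rho> = 1 - r * C"
  have r: "r > 0" "r * D = 1" using CD by (auto simp: r_def)
  have \<rho>: "0 \<le> \<rho>" "\<rho> < 1" using CD r by (auto simp: \<rho>_def r_def field_simps)
  \<comment> \<open>Real scalars act on the module through multiples of the unit.\<close>
  define R where "R x = x - act (r *\<^sub>R 1) (S x)" for x
  have R_add: "R (x + y) = R x + R y" for x y by (simp add: R_def S_add act_add_right)
  have R_diff: "R (x - y) = R x - R y" for x y using R_add[of "x - y" y] by simp
  have R_act: "R (act a x) = act a (R x)" for a x
  proof -
    have "act (r *\<^sub>R 1) (act a u) = act a (act (r *\<^sub>R 1) u)" for u by (simp flip: act_mult)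
    moreover have "act a (u - v) = act a u - act a v" for u v
      using act_add_right[of a "u - v" v] by simp
    ultimately show ?thesis by (simp add: R_def S_act)
  qed
  have ipR: "ip (R x) y = ip x y - r *\<^sub>R ip (S x) y" for x y
    by (simp add: R_def ip_diff_left ip_act_left)
  have R_adj: "ip (R x) y = ip x (R y)" for x y
    by (simp add: R_def ip_diff_left ip_diff_right ip_act_left ip_act_right S_adjoint st_scaleR)
  have R_pos: "pos (ip (R x) x)" for x
    using pos_scaleR[OF CD(4)[of x], of r] r by (simp add: ipR scaleR_diff_right)
  have "pos (\<rho> *\<^sub>R ip x x - ip (R x) x)" for x
    using pos_scaleR[OF CD(3)[of x], of r] r by (simp add: ipR \<rho>_def algebra_simps)
  then have form: "norm (ip (R x) x) \<le> \<rho> * (hnorm ip x)\<^sup>2" for x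
    using pos_norm_mono[OF R_pos] \<rho> by (fastforce simp: hnorm_square)
  have bound: "hnorm ip (R x) \<le> \<rho> * hnorm ip x" for x
  proof (cases "hnorm ip (R x) = 0")
    case False
    \<comment> \<open>Cauchy-Schwarz for the form of \<open>R\<close> at \<open>x\<close> and
      \<open>R x\<close> turns the form bound into an operator bound; \<open>?a\<close> squared
      cancels.\<close>
    let ?a = "hnorm ip (R x)"
    have "(?a\<^sup>2)\<^sup>2 \<le> norm (ip (R x) x) * norm (ip (R (R x)) (R x))"
      unfolding hnorm_square by (rule form_Cauchy_Schwarz[OF R_add R_act R_adj R_pos])
    also have "\<dots> \<le> (\<rho> * (hnorm ip x)\<^sup>2) * (\<rho> * ?a\<^sup>2)"
      using \<rho> by (intro mult_mono form) auto
    also have "\<dots> = (\<rho> * hnorm ip x)\<^sup>2 * ?a\<^sup>2" by (simp add: power2_eq_square)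
    finally have "?a\<^sup>2 * ?a\<^sup>2 \<le> (\<rho> * hnorm ip x)\<^sup>2 * ?a\<^sup>2" by (simp only: power2_eq_square)
    then have "?a\<^sup>2 \<le> (\<rho> * hnorm ip x)\<^sup>2"
      by (rule mult_right_le_imp_le) (use False in simp)
    then show ?thesis by (rule power2_le_imp_le) (use \<rho> in simp)
  qed (use \<rho> in auto)
  have "\<exists>x. act (r *\<^sub>R 1) z + R x = x"
    by (rule contraction_fixpoint[OF _ \<rho>]) (simp add: bound flip: R_diff)
  then obtain x where "act (r *\<^sub>R 1) (S x) = act (r *\<^sub>R 1) z" by (auto simp: R_def algebra_simps)
  \<comment> \<open>Acting with \<open>D\<close> undoes \<open>r\<close>, as
    \<open>r * D = 1\<close>.\<close>
  then have "act (D *\<^sub>R 1 * r *\<^sub>R 1) (S x) = act (D *\<^sub>R 1 * r *\<^sub>R 1) z" by (simp only: act_mult)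
  then show ?thesis using r by (auto simp: mult.commute)
qed

text \<open>From the lower frame bound and Cauchy-Schwarz; it gives injectivity of \<open>S\<close>
  and boundedness of the inverse.\<close>

lemma S_bounded_below: "\<exists>C>0. \<forall>x. C * hnorm ip x \<le> hnorm ip (S x)"
proof -
  obtain C D where CD: "0 < C" "C \<le> D"
    "\<And>x. pos (ip (S x) x - C *\<^sub>R ip x x)" "\<And>x. pos (D *\<^sub>R ip x x - ip (S x) x)"
    by (rule S_bounds) blast
  have "C * hnorm ip x \<le> hnorm ip (S x)" for x
  proof (cases "hnorm ip x = 0")
    case False
    have "norm (C *\<^sub>R ip x x) \<le> norm (ip (S x) x)"
      using CD by (intro pos_norm_mono pos_scaleR pos_ip) auto
    also have "\<dots> \<le> hnorm ip (S x) * hnorm ip x" by (rule Cauchy_Schwarz)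
    finally have "C * hnorm ip x * hnorm ip x \<le> hnorm ip (S x) * hnorm ip x"
      using CD by (simp add: hnorm_square[symmetric] power2_eq_square mult.assoc)
    then show ?thesis using False hnorm_nonneg[of x] by (simp add: mult_le_cancel_right)
  qed simp
  then show ?thesis using CD by blast
qed

lemma bij_S: "bij S"
proof (rule bijI)
  obtain C where C: "C > 0" "\<And>x. C * hnorm ip x \<le> hnorm ip (S x)" using S_bounded_below by blast
  show "inj S"
  proof (rule injI)
    fix x y assume "S x = S y"
    then have "C * hnorm ip (x - y) \<le> 0" using C(2)[of "x - y"] by (simp add: S_diff)
    then have "hnorm ip (x - y) = 0" using C(1) hnorm_nonneg[of "x - y"]
      by (simp add: mult_le_0_iff)
    then have "x - y = 0" by (rule hnorm_eq_zeroD)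
    then show "x = y" by simp
  qed
  show "surj S" using S_surj by (metis surjI)
qed

definition S' :: "'h \<Rightarrow> 'h" where "S' = inv S"

lemma S_S' [simp]: "S (S' x) = x" and S'_S [simp]: "S' (S x) = x"
  using bij_S unfolding S'_def by (simp_all add: bij_is_surj surj_f_inv_f bij_is_inj)

lemma S'_add: "S' (x + y) = S' x + S' y"
  by (metis S_add S_S' S'_S)

lemma S'_act: "S' (act a x) = act a (S' x)"
  by (metis S_act S_S' S'_S)

lemma S'_adjoint: "ip (S' x) y = ip x (S' y)"
  using S_adjoint[of "S' x" "S' y"] by simp

lemma S'_bounded: "\<exists>K\<ge>0. \<forall>x. hnorm ip (S' x) \<le> K * hnorm ip x"
proof -
  obtain C where C: "C > 0" "\<And>x. C * hnorm ip x \<le> hnorm ip (S x)" using S_bounded_below by blast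
  have "hnorm ip (S' x) \<le> inverse C * hnorm ip x" for x
    using C(2)[of "S' x"] C(1) by (simp add: field_simps)
  then show ?thesis using C(1) by (intro exI[of _ "inverse C"]) auto
qed

text \<open>Antisymmetry of the order makes the form of \<open>S - 1\<close> vanish on the diagonal;
  Cauchy-Schwarz for that form makes it vanish everywhere.\<close>

lemma S_eq_id_if_nt:
  assumes "standard_nt_frame cs st ip J xs" shows "S x = x"
proof -
  have ipS: "ip (S x) x = ip x x" for x
  proof -
    obtain s where s: "psum J (\<lambda>j. ip x (xs j) * ip (xs j) x) \<longlonglongrightarrow> s"
      and cle: "cle cs st (ip x x) s" "cle cs st s (ip x x)"
      using assms unfolding standard_nt_frame_def by blast
    have "pos (s - ip x x)" "pos (ip x x - s)"
      using cle unfolding cle_def by (simp_all only: pos_if_cpos)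
    then have "s - ip x x = 0" by (intro pos_antisym) simp_all
    moreover have "ip (S x) x = s"
      by (rule LIMSEQ_unique[OF ip_S s[folded st_an, folded an_def]])
    ultimately show ?thesis by simp
  qed
  define R where "R x = S x - x" for x
  have act_diff: "act a (u - v) = act a u - act a v" for a u v
    using act_add_right[of a "u - v" v] by simp
  have "(norm (ip (R x) y))\<^sup>2 \<le> norm (ip (R x) x) * norm (ip (R y) y)" for y
    by (rule form_Cauchy_Schwarz)
      (simp_all add: R_def S_add S_act act_diff ip_diff_left ip_diff_right S_adjoint, simp add: ipS flip: S_adjoint)
  then have "ip (R x) y = 0" for y by (simp add: R_def ip_diff_left ipS)
  then have "R x = 0" by (intro ip_eqI) simp
  then show ?thesis by (simp add: R_def)
qed

text \<open>Equal coefficients have equal synthesis, so \<open>S x = S y\<close>, and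
  \<open>S\<close> is injective.\<close>

lemma an_injective:
  assumes "\<And>j. j \<in> J \<Longrightarrow> ip x (xs j) = ip y (xs j)" shows "x = y"
proof -
  have "psum J (\<lambda>j. act (an x j) (xs j)) = psum J (\<lambda>j. act (an y j) (xs j))"
    using assms unfolding psum_def an_def by (intro ext sum.cong) auto
  then have "S x = S y" unfolding S_def syn_def by simp
  then show ?thesis by (metis S'_S)
qed

end

section \<open>Ranges and kernels\<close>

lemma frame_transform_eq_iff:
  "frame_transform ip J xs x = frame_transform ip' J ys y \<longleftrightarrow> (\<forall>j\<in>J. ip x (xs j) = ip' y (ys j))"
  by (auto simp: frame_transform_def fun_eq_iff)

lemma range_frame_transform_subset_iff:
  "range (frame_transform ip J xs) \<subseteq> range (frame_transform ip' J ys) \<longleftrightarrow>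
     (\<forall>x. \<exists>y. \<forall>j\<in>J. ip x (xs j) = ip' y (ys j))"
  unfolding frame_transform_eq_iff[symmetric] by blast

section \<open>Operators carrying one frame to the other, and comparison of ranges and
  kernels\<close>

context frame_pair
begin

lemma hconv_image:
  assumes "A_linear act1 act2 U" "\<And>x. hnorm ip2 (U x) \<le> K * hnorm ip1 x" "hconv ip1 f l"
  shows "hconv ip2 (\<lambda>n. U (f n)) (U l)"
proof (rule F2.hconv_bounded)
  have add: "U (x + y) = U x + U y" for x y using assms(1) by (simp add: A_linear_def)
  have diff: "U (x - y) = U x - U y" for x y using add[of "x - y" y] by simp
  show "hnorm ip2 (U (f n) - U l) \<le> K * hnorm ip1 (f n - l)" for n
    using assms(2)[of "f n - l"] by (simp add: diff)
  show "(\<lambda>n. K * hnorm ip1 (f n - l)) \<longlonglongrightarrow> 0"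
    using assms(3) unfolding hconv_def by (rule tendsto_mult_right_zero)
qed

lemma linear_zero:
  assumes "A_linear act1 act2 U" shows "U 0 = 0"
proof -
  have "U (0 + 0) = U 0 + U 0" using assms unfolding A_linear_def by blast
  then show ?thesis by simp
qed

lemma psum_image:
  assumes U: "A_linear act1 act2 U" and xy: "\<forall>j\<in>J. U (xs j) = ys j"
  shows "U (psum J (\<lambda>j. act1 (c j) (xs j)) N) = psum J (\<lambda>j. act2 (c j) (ys j)) N"
proof -
  have "U (\<Sum>i\<in>I. g i) = (\<Sum>i\<in>I. U (g i))" for g and I :: "nat set"
    using U linear_zero[OF U] by (induction I rule: infinite_finite_induct) (auto simp: A_linear_def)
  then show ?thesis unfolding psum_def using U xy by (simp add: A_linear_def)
qed

text \<open>\<open>U\<close> maps partial sums to partial sums and is continuous, while membership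
  in \<open>l2_dual\<close> does not involve the frame.\<close>

lemma synth_kernel_subset:
  assumes U: "A_linear act1 act2 U" "\<And>x. hnorm ip2 (U x) \<le> K * hnorm ip1 x"
    and xy: "\<forall>j\<in>J. U (xs j) = ys j"
  shows "synth_kernel st act1 ip1 J xs \<subseteq> synth_kernel st act2 ip2 J ys"
proof
  fix a assume a: "a \<in> synth_kernel st act1 ip1 J xs"
  then have "hconv ip1 (psum J (\<lambda>j. act1 (a j) (xs j))) 0" by (simp add: synth_kernel_def)
  from hconv_image[OF U this] have "hconv ip2 (psum J (\<lambda>j. act2 (a j) (ys j))) 0"
    unfolding psum_image[OF U(1) xy] linear_zero[OF U(1)] .
  then show "a \<in> synth_kernel st act2 ip2 J ys" using a by (simp add: synth_kernel_def)
qed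

text \<open>The adjoint \<open>V\<close> gives one inclusion at once. The other needs an adjoint of
  the inverse of \<open>U\<close>, which a similarity does not supply directly.\<close>

lemma range_eq_if_similarity:
  assumes U: "similarity_op act1 ip1 act2 ip2 U" and xy: "\<forall>j\<in>J. U (xs j) = ys j"
  shows "range (frame_transform ip1 J xs) = range (frame_transform ip2 J ys)"
proof
  obtain K V where lin: "A_linear act1 act2 U" and K: "\<And>x. hnorm ip2 (U x) \<le> K * hnorm ip1 x"
    and V: "\<And>x y. ip2 (U x) y = ip1 x (V y)" and inj: "inj U"
    using U unfolding similarity_op_def is_adjoint_def bij_def by blast
  have "ip2 y (ys j) = ip1 (V y) (xs j)" if "j \<in> J" for y j
    using arg_cong[OF V[of "xs j" y], of st] xy[rule_format, OF that] by (simp add: F1.st_ip F2.st_ip)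
  then show "range (frame_transform ip2 J ys) \<subseteq> range (frame_transform ip1 J xs)"
    unfolding range_frame_transform_subset_iff by blast
  txt \<open>The reconstruction formula of the second frame shows that \<open>G' \<circ> F2.S'\<close>, which has an adjoint,
    is the inverse of \<open>U\<close>.\<close>
  have UW: "U (G' (F2.S' y)) = y" for y
  proof -
    let ?c = "F2.an (F2.S' y)"
    have "hconv ip1 (psum J (\<lambda>j. act1 (?c j) (xs j))) (G' (F2.S' y))"
      unfolding G'_def by (rule F1.hconv_syn) simp
    from hconv_image[OF lin K this]
    have "hconv ip2 (psum J (\<lambda>j. act2 (?c j) (ys j))) (U (G' (F2.S' y)))"
      unfolding psum_image[OF lin xy] .
    from F2.syn_eqI[OF F2.l2_an this] have "F2.S (F2.S' y) = U (G' (F2.S' y))"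
      by (simp only: F2.S_def)
    then show ?thesis by simp
  qed
  have W: "G' (F2.S' (ys j)) = xs j" if "j \<in> J" for j
    using UW[of "ys j"] xy[rule_format, OF that] by (intro injD[OF inj]) simp
  have "ip1 x (xs j) = ip2 (F2.S' (G x)) (ys j)" if "j \<in> J" for x j
    using G_adjoint[of x "F2.S' (ys j)"] by (simp add: W[OF that] F2.S'_adjoint)
  then show "range (frame_transform ip1 J xs) \<subseteq> range (frame_transform ip2 J ys)"
    unfolding range_frame_transform_subset_iff by blast
qed

text \<open>\<open>V\<close> is adjoint and inverse at once: \<open>y\<close> has the coefficients
  of \<open>V y\<close>, and \<open>x\<close> those of \<open>U x\<close>.\<close>

lemma range_eq_if_unitary:
  assumes U: "unitary_op act1 ip1 act2 ip2 U" and xy: "\<forall>j\<in>J. U (xs j) = ys j"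
  shows "range (frame_transform ip1 J xs) = range (frame_transform ip2 J ys)"
proof
  obtain V where V: "\<And>x y. ip2 (U x) y = ip1 x (V y)" and VU: "\<And>x. V (U x) = x"
    using U unfolding unitary_op_def is_adjoint_def by blast
  have "ip2 y (ys j) = ip1 (V y) (xs j)" if "j \<in> J" for y j
    using arg_cong[OF V[of "xs j" y], of st] xy[rule_format, OF that] by (simp add: F1.st_ip F2.st_ip)
  then show "range (frame_transform ip2 J ys) \<subseteq> range (frame_transform ip1 J xs)"
    unfolding range_frame_transform_subset_iff by blast
  have "ip1 x (xs j) = ip2 (U x) (ys j)" if "j \<in> J" for x j
    using V[of x "U (xs j)", unfolded VU] xy that by simp
  then show "range (frame_transform ip1 J xs) \<subseteq> range (frame_transform ip2 J ys)"
    unfolding range_frame_transform_subset_iff by blast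
qed

text \<open>If \<open>y\<close> has the coefficients of \<open>x\<close>, synthesis by
  \<open>ys\<close> gives \<open>F2.S y = G x\<close>, which determines \<open>y\<close>.\<close>

lemma coefficients_transfer:
  assumes "range (frame_transform ip1 J xs) \<subseteq> range (frame_transform ip2 J ys)" "j \<in> J"
  shows "ip2 (F2.S' (G x)) (ys j) = ip1 x (xs j)"
proof -
  obtain y where y: "\<And>j. j \<in> J \<Longrightarrow> ip1 x (xs j) = ip2 y (ys j)"
    using assms(1) unfolding range_frame_transform_subset_iff by blast
  have "psum J (\<lambda>j. act2 (F2.an y j) (ys j)) = psum J (\<lambda>j. act2 (F1.an x j) (ys j))"
    unfolding psum_def F1.an_def F2.an_def by (intro ext sum.cong) (auto simp: y)
  then have "F2.S y = G x" unfolding F2.S_def G_def F2.syn_def by simp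
  then have "F2.S' (G x) = y" by (metis F2.S'_S)
  then show ?thesis using y[OF assms(2)] by simp
qed

text \<open>\<open>c\<close> is the part of the coefficients of \<open>x\<close> orthogonal to the
  second range; the kernel hypothesis makes it orthogonal to the first range as well, hence to
  itself.\<close>

lemma range_subset_if_kernel_subset:
  assumes ker: "synth_kernel st act2 ip2 J ys \<subseteq> synth_kernel st act1 ip1 J xs"
  shows "range (frame_transform ip1 J xs) \<subseteq> range (frame_transform ip2 J ys)"
  unfolding range_frame_transform_subset_iff
proof
  fix x
  \<comment> \<open>The only candidate, by \<open>coefficients_transfer\<close>.\<close>
  define y where "y = F2.S' (G x)"
  define c where "c j = F1.an x j - F2.an y j" for j
  \<comment> \<open>\<open>l2_dual\<close> demands zeros outside \<open>J\<close>; this supplies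
    them without changing sums over \<open>J\<close>.\<close>
  define c' where "c' j = (if j \<in> J then c j else 0)" for j
  have c'_psum: "psum J (\<lambda>j. f (c' j) j) = psum J (\<lambda>j. f (c j) j)" for f :: "'a \<Rightarrow> nat \<Rightarrow> 'z::comm_monoid_add"
    unfolding psum_def c'_def by (intro ext sum.cong) auto
  obtain p q where p: "psum J (\<lambda>j. F1.an x j * st (F1.an x j)) \<longlonglongrightarrow> p"
    and q: "psum J (\<lambda>j. F2.an y j * st (F2.an y j)) \<longlonglongrightarrow> q"
    using F1.l2_an[of x] F2.l2_an[of y] unfolding F1.l2_def F2.l2_def convergent_def by blast
  \<comment> \<open>Expanding into four series known to converge shows that \<open>c\<close> is
    square summable.\<close>
  have "psum J (\<lambda>j. c j * st (c j)) =
     (\<lambda>N. psum J (\<lambda>j. F1.an x j * st (F1.an x j)) N - psum J (\<lambda>j. ip1 x (xs j) * ip2 (ys j) y) N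
       - psum J (\<lambda>j. ip2 y (ys j) * ip1 (xs j) x) N + psum J (\<lambda>j. F2.an y j * st (F2.an y j)) N)"
    unfolding psum_def sum_subtractf[symmetric] sum.distrib[symmetric]
    by (intro ext sum.cong refl)
      (simp add: c_def F1.an_def F2.an_def st_diff F1.st_ip F2.st_ip algebra_simps)
  then have "psum J (\<lambda>j. c j * st (c j)) \<longlonglongrightarrow> p - ip2 (G x) y - ip1 (G' y) x + q"
    by (simp only:) (intro tendsto_add tendsto_diff p q ip_G ip_G')
  then have conv: "convergent (psum J (\<lambda>j. c j * st (c j)))" by (rule convergentI)
  then have l2: "F1.l2 c" "F2.l2 c" by (simp_all only: F1.l2_def F2.l2_def)
  have "Bseq (psum J (\<lambda>j. c' j * st (c' j)))"
    unfolding c'_psum[of "\<lambda>a j. a * st a"] using conv by (rule convergent_imp_Bseq)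
  then obtain B where "\<forall>N. norm (psum J (\<lambda>j. c' j * st (c' j)) N) \<le> B"
    unfolding Bseq_def by blast
  then have dual: "c' \<in> l2_dual st J" by (auto simp: l2_dual_def c'_def intro: bdd_aboveI)
  have "F2.syn (\<lambda>j. c j + F2.an y j) = F2.syn c + F2.syn (F2.an y)"
    by (rule F2.syn_add[OF l2(2) F2.l2_an]) (simp add: c_def)
  moreover have "F2.syn (F2.an y) = G x" by (simp add: y_def flip: F2.S_def)
  ultimately have syn2: "F2.syn c = 0" by (simp add: c_def flip: G_def)
  have "c' \<in> synth_kernel st act2 ip2 J ys"
    using dual F2.hconv_syn[OF l2(2)] unfolding synth_kernel_def syn2
    by (simp add: c'_psum[of "\<lambda>a j. act2 a (ys j)"])
  then have "c' \<in> synth_kernel st act1 ip1 J xs" using ker by blast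
  then have "hconv ip1 (psum J (\<lambda>j. act1 (c j) (xs j))) 0"
    by (simp add: synth_kernel_def c'_psum[of "\<lambda>a j. act1 a (xs j)"])
  then have syn1: "F1.syn c = 0" by (rule F1.syn_eqI[OF l2(1)])
  \<comment> \<open>The pairing of \<open>c\<close> with itself, split along its definition; both
    parts vanish because both syntheses of \<open>c\<close> do.\<close>
  have "(\<lambda>N. psum J (\<lambda>j. c j * ip1 (xs j) x) N - psum J (\<lambda>j. c j * ip2 (ys j) y) N) \<longlonglongrightarrow> 0 - 0"
    using F1.ip_syn[OF l2(1), of x] F2.ip_syn[OF l2(2), of y] unfolding syn1 syn2
    by (intro tendsto_diff) simp_all
  moreover have "psum J (\<lambda>j. c j * ip1 (xs j) x) N - psum J (\<lambda>j. c j * ip2 (ys j) y) N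
     = psum J (\<lambda>j. c j * st (c j)) N" for N
    unfolding psum_def sum_subtractf[symmetric]
    by (intro sum.cong refl) (simp add: c_def st_diff F1.st_an F2.st_an algebra_simps)
  ultimately have lim: "psum J (\<lambda>j. c j * st (c j)) \<longlonglongrightarrow> 0" by simp
  have "c j = 0" if j: "j \<in> J" for j
  proof -
    \<comment> \<open>From \<open>Suc j\<close> on, the partial sums contain the term at
      \<open>j\<close>, and the other terms are positive.\<close>
    have le: "norm (c j * st (c j)) \<le> norm (psum J (\<lambda>j. c j * st (c j)) N)" if "N \<ge> Suc j" for N
    proof (rule pos_norm_mono[OF pos_mult_st])
      have "psum J (\<lambda>j. c j * st (c j)) N - c j * st (c j) = (\<Sum>i\<in>J \<inter> {..<N} - {j}. c i * st (c i))"
        unfolding psum_def using j that by (subst sum_diff1) auto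
      then show "pos (psum J (\<lambda>j. c j * st (c j)) N - c j * st (c j))"
        by (simp only: pos_sum pos_mult_st)
    qed
    have "norm (c j * st (c j)) \<le> norm (0::'a)"
      by (rule LIMSEQ_le_const[OF tendsto_norm[OF lim]]) (use le in blast)
    then show ?thesis by (simp add: norm_mult_st)
  qed
  then show "\<exists>y. \<forall>j\<in>J. ip1 x (xs j) = ip2 y (ys j)"
    by (intro exI[of _ y] ballI) (simp add: c_def F1.an_def F2.an_def)
qed

interpretation sym: frame_pair cs st act2 ip2 act1 ip1 J ys xs
  by unfold_locales

lemma sym_G: "sym.G = G'" "sym.G' = G"
  by (simp_all add: fun_eq_iff G_def G'_def sym.G_def sym.G'_def)

section \<open>Equal ranges: the transfer operator \<open>F2.S' \<circ> G\<close> and its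
  adjoint\<close>

context
  assumes ranges: "range (frame_transform ip1 J xs) = range (frame_transform ip2 J ys)"
begin

lemma coeff: "j \<in> J \<Longrightarrow> ip2 (F2.S' (G x)) (ys j) = ip1 x (xs j)"
  using coefficients_transfer ranges by blast

lemma coeff': "j \<in> J \<Longrightarrow> ip1 (F1.S' (G' y)) (xs j) = ip2 y (ys j)"
  using sym.coefficients_transfer[unfolded sym_G] ranges by blast

lemma transfer_inverse: "F1.S' (G' (F2.S' (G x))) = x"
  by (rule F1.an_injective) (simp add: coeff coeff')

lemma transfer_inverse': "F2.S' (G (F1.S' (G' y))) = y"
  by (rule F2.an_injective) (simp add: coeff coeff')

lemma transfer_adjoint: "ip2 (F2.S' (G x)) y = ip1 x (G' (F2.S' y))"
  by (simp add: F2.S'_adjoint G_adjoint)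

lemma transfer_adjoint': "ip1 (F1.S' (G' y)) x = ip2 y (G (F1.S' x))"
  using sym.G_adjoint[of y "F1.S' x"] by (simp add: F1.S'_adjoint sym_G)

text \<open>\<open>G \<circ> F1.S'\<close> is adjoint to the inverse transfer
  \<open>F1.S' \<circ> G'\<close>, which preserves coefficients: pairing \<open>y\<close> with
  either side gives \<open>ip2 y (ys j)\<close>.\<close>

lemma transfer_frame: "j \<in> J \<Longrightarrow> G (F1.S' (xs j)) = ys j"
  by (rule F2.ip_eqI_right) (simp add: coeff' flip: transfer_adjoint')

lemma similarity_op_transfer: "similarity_op act1 ip1 act2 ip2 (\<lambda>x. G (F1.S' x))"
  unfolding similarity_op_def
proof (intro conjI)
  show "A_linear act1 act2 (\<lambda>x. G (F1.S' x))"
    by (simp add: A_linear_def F1.S'_add F1.S'_act G_add G_act)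
  obtain K L where K: "K \<ge> 0" "\<And>x. hnorm ip2 (G x) \<le> K * hnorm ip1 x"
    and L: "\<And>x. hnorm ip1 (F1.S' x) \<le> L * hnorm ip1 x"
    using G_bounded F1.S'_bounded by blast
  have "hnorm ip2 (G (F1.S' x)) \<le> (K * L) * hnorm ip1 x" for x
    using K(2)[of "F1.S' x"] mult_left_mono[OF L[of x] K(1)] by (simp add: mult.assoc)
  then show "\<exists>K. \<forall>x. hnorm ip2 (G (F1.S' x)) \<le> K * hnorm ip1 x" by blast
  have "is_adjoint ip1 ip2 (\<lambda>x. G (F1.S' x)) (\<lambda>y. F1.S' (G' y))"
    by (simp add: is_adjoint_def G_adjoint F1.S'_adjoint)
  then show "\<exists>V. is_adjoint ip1 ip2 (\<lambda>x. G (F1.S' x)) V"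
    by (rule exI[where P = "is_adjoint ip1 ip2 (\<lambda>x. G (F1.S' x))" and x = "\<lambda>y. F1.S' (G' y)"])
  \<comment> \<open>The inverse is the adjoint of the transfer operator; these are the adjoints of
    the identities in \<open>transfer_inverse\<close> and \<open>transfer_inverse'\<close>.\<close>
  have "G' (F2.S' (G (F1.S' x))) = x" for x
    by (rule F1.ip_eqI_right) (simp add: transfer_inverse flip: transfer_adjoint transfer_adjoint')
  moreover have "G (F1.S' (G' (F2.S' y))) = y" for y
    by (rule F2.ip_eqI_right) (simp add: transfer_inverse' flip: transfer_adjoint transfer_adjoint')
  ultimately show "bij (\<lambda>x. G (F1.S' x))"
    by (intro o_bij[of "\<lambda>y. G' (F2.S' y)"]) (simp_all add: fun_eq_iff)
qed

lemma similar_if_range_eq: "similar_frames act1 ip1 act2 ip2 J xs ys"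
  unfolding similar_frames_def using similarity_op_transfer transfer_frame by blast

lemma kernel_subset_if_range_eq:
  "synth_kernel st act1 ip1 J xs \<subseteq> synth_kernel st act2 ip2 J ys"
  using similarity_op_transfer transfer_frame synth_kernel_subset
  unfolding similarity_op_def by meson

text \<open>Both frame operators are the identity, so the transfer operator is \<open>G\<close>, and
  its inverse is the adjoint \<open>G'\<close>.\<close>

lemma unitary_if_range_eq:
  assumes "standard_nt_frame cs st ip1 J xs" "standard_nt_frame cs st ip2 J ys"
  shows "unitarily_equivalent_frames act1 ip1 act2 ip2 J xs ys"
proof -
  have S': "F1.S' x = x" "F2.S' y = y" for x y
    using F1.S_eq_id_if_nt[OF assms(1), of "F1.S' x"] F2.S_eq_id_if_nt[OF assms(2), of "F2.S' y"]
    by simp_all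
  have "is_adjoint ip1 ip2 G G'" by (simp add: is_adjoint_def G_adjoint)
  moreover have "\<forall>x. G' (G x) = x" "\<forall>y. G (G' y) = y"
    using transfer_inverse transfer_inverse' by (simp_all add: S')
  moreover have "A_linear act1 act2 G" by (simp add: A_linear_def G_add G_act)
  ultimately have "unitary_op act1 ip1 act2 ip2 G" unfolding unitary_op_def by blast
  moreover have "\<forall>j\<in>J. G (xs j) = ys j" using transfer_frame by (simp add: S')
  ultimately show ?thesis unfolding unitarily_equivalent_frames_def by blast
qed

end

section \<open>The equivalences\<close>

lemma similar_iff_range_eq:
  "similar_frames act1 ip1 act2 ip2 J xs ys \<longleftrightarrow>
     range (frame_transform ip1 J xs) = range (frame_transform ip2 J ys)"
  using similar_if_range_eq range_eq_if_similarity unfolding similar_frames_def by blast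

lemma unitarily_equivalent_iff_range_eq:
  assumes "standard_nt_frame cs st ip1 J xs" "standard_nt_frame cs st ip2 J ys"
  shows "unitarily_equivalent_frames act1 ip1 act2 ip2 J xs ys \<longleftrightarrow>
     range (frame_transform ip1 J xs) = range (frame_transform ip2 J ys)"
  using unitary_if_range_eq[OF _ assms] range_eq_if_unitary
  unfolding unitarily_equivalent_frames_def by blast

end

context frame_pair
begin

text \<open>Repeated after reopening the locale, so that the facts proved meanwhile are also
  available with the frames exchanged.\<close>

interpretation sym: frame_pair cs st act2 ip2 act1 ip1 J ys xs
  by unfold_locales

lemma range_eq_iff_kernel_eq:
  "range (frame_transform ip1 J xs) = range (frame_transform ip2 J ys) \<longleftrightarrow>
     synth_kernel st act1 ip1 J xs = synth_kernel st act2 ip2 J ys"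
  using kernel_subset_if_range_eq sym.kernel_subset_if_range_eq
    range_subset_if_kernel_subset sym.range_subset_if_kernel_subset
  by (intro iffI equalityI) simp_all

end

lemma standard_frame_if_nt: "standard_nt_frame cs st ip J xs \<Longrightarrow> standard_frame cs st ip J xs"
  unfolding standard_nt_frame_def standard_frame_def
  by (intro exI[of _ 1]) simp

theorem theorem7p2:
  fixes cs :: "complex \<Rightarrow> 'a::{real_normed_algebra_1,banach} \<Rightarrow> 'a"
    and st :: "'a \<Rightarrow> 'a"
    and act1 :: "'a \<Rightarrow> 'h1::ab_group_add \<Rightarrow> 'h1" and ip1 :: "'h1 \<Rightarrow> 'h1 \<Rightarrow> 'a"
    and act2 :: "'a \<Rightarrow> 'h2::ab_group_add \<Rightarrow> 'h2" and ip2 :: "'h2 \<Rightarrow> 'h2 \<Rightarrow> 'a"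
    and J :: "nat set"
    and xs :: "nat \<Rightarrow> 'h1" and ys :: "nat \<Rightarrow> 'h2"
  assumes "cstar_algebra cs st"
    and "hilbert_module cs st act1 ip1"
    and "hilbert_module cs st act2 ip2"
  shows "(standard_nt_frame cs st ip1 J xs \<and> standard_nt_frame cs st ip2 J ys \<longrightarrow>
            (unitarily_equivalent_frames act1 ip1 act2 ip2 J xs ys \<longleftrightarrow>
               range (frame_transform ip1 J xs) = range (frame_transform ip2 J ys)) \<and>
            (range (frame_transform ip1 J xs) = range (frame_transform ip2 J ys) \<longleftrightarrow>
               synth_kernel st act1 ip1 J xs = synth_kernel st act2 ip2 J ys))
       \<and> (standard_frame cs st ip1 J xs \<and> standard_frame cs st ip2 J ys \<longrightarrow>
            (similar_frames act1 ip1 act2 ip2 J xs ys \<longleftrightarrow>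
               range (frame_transform ip1 J xs) = range (frame_transform ip2 J ys)) \<and>
            (range (frame_transform ip1 J xs) = range (frame_transform ip2 J ys) \<longleftrightarrow>
               synth_kernel st act1 ip1 J xs = synth_kernel st act2 ip2 J ys))"
proof -
  have pair: "frame_pair cs st act1 ip1 act2 ip2 J xs ys"
    if "standard_frame cs st ip1 J xs" "standard_frame cs st ip2 J ys"
    using assms that by unfold_locales
  show ?thesis
  proof (intro conjI impI; elim conjE)
    assume nt: "standard_nt_frame cs st ip1 J xs" "standard_nt_frame cs st ip2 J ys"
    then interpret frame_pair cs st act1 ip1 act2 ip2 J xs ys
      by (intro pair standard_frame_if_nt)
    show "unitarily_equivalent_frames act1 ip1 act2 ip2 J xs ys \<longleftrightarrow>
       range (frame_transform ip1 J xs) = range (frame_transform ip2 J ys)"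
      by (rule unitarily_equivalent_iff_range_eq[OF nt])
    show "range (frame_transform ip1 J xs) = range (frame_transform ip2 J ys) \<longleftrightarrow>
       synth_kernel st act1 ip1 J xs = synth_kernel st act2 ip2 J ys"
      by (rule range_eq_iff_kernel_eq)
  next
    assume "standard_frame cs st ip1 J xs" "standard_frame cs st ip2 J ys"
    then interpret frame_pair cs st act1 ip1 act2 ip2 J xs ys by (rule pair)
    show "similar_frames act1 ip1 act2 ip2 J xs ys \<longleftrightarrow>
       range (frame_transform ip1 J xs) = range (frame_transform ip2 J ys)"
      by (rule similar_iff_range_eq)
    show "range (frame_transform ip1 J xs) = range (frame_transform ip2 J ys) \<longleftrightarrow>
       synth_kernel st act1 ip1 J xs = synth_kernel st act2 ip2 J ys"
      by (rule range_eq_iff_kernel_eq)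
  qed
qed

end
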